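(* Let $r\geq 3$ and $k\geq 2$ be integers. Let $c_1=128r^{2r+3}$ and $c_2=\log (64kr^{2r+2})$. If $G$ is an $n$-vertex linear $r$-graph with average degree $d(G)\geq c_1 k$, then $G$ contains linear cycles of $k$ consecutive even lengths, the shortest of which has length at most $$2\left\lceil \frac{\log n}{\log (d(G)/k)-c_2}\right\rceil .$$
   Context: All (hyper)graphs are finite. An $r$-graph is an $r$-uniform hypergraph. An $r$-graph is linear if any two distinct edges share at most one vertex. An $r$-uniform linear cycle of length $\ell\ge 3$ is an $r$-graph consisting of $\ell$ edges $e_1,\dots,e_\ell$ on $(r-1)\ell$ vertices such that $|e_i\cap e_j|=1$ if $j=i\pm 1$ (indices modulo $\ell$) and $|e_i\cap e_j|=0$ for all other $i\ne j$. The average degree $d(G)$ of an $n$-vertex $r$-graph is $r\,e(G)/n$, where $e(G)$ is the number of edges. "Linear cycles of $k$ consecutive even lengths" means linear cycles of lengths $a,a+2,\dots,a+2(k-1)$ for some even integer $a$. Logarithms are base $2$.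
   Formalization: The bound on the shortest length is asserted only when log(d(G)/k) − c_2 > 0; otherwise (possible when k ≥ 2r) it is undefined or non-positive, hence false, and only the existence of the k cycles is claimed. *)

theory Defs
  imports Complex_Main
begin

definition r_graph :: "nat \<Rightarrow> 'a set \<Rightarrow> 'a set set \<Rightarrow> bool" where
  "r_graph r V E \<longleftrightarrow> finite V \<and> (\<forall>e\<in>E. e \<subseteq> V \<and> card e = r)"

definition linear_hypergraph :: "'a set set \<Rightarrow> bool" where
  "linear_hypergraph E \<longleftrightarrow> (\<forall>e\<in>E. \<forall>f\<in>E. e \<noteq> f \<longrightarrow> card (e \<inter> f) \<le> 1)"

definition avg_degree :: "nat \<Rightarrow> 'a set \<Rightarrow> 'a set set \<Rightarrow> real" where
  "avg_degree r V E = real r * real (card E) / real (card V)"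

(* The edges are indexed by 0, ..., l - 1 and the indices read modulo l.  For l = 3 the
   condition on card W is not redundant: it excludes three edges through a common vertex. *)
definition linear_cycle :: "nat \<Rightarrow> nat \<Rightarrow> 'a set \<Rightarrow> 'a set set \<Rightarrow> bool" where
  "linear_cycle r l W C \<longleftrightarrow>
     l \<ge> 3 \<and> r_graph r W C \<and> card W = (r - 1) * l \<and>
     (\<exists>e. bij_betw e {..<l} C \<and>
        (\<forall>i<l. \<forall>j<l. i \<noteq> j \<longrightarrow>
           card (e i \<inter> e j) = (if j = Suc i mod l \<or> i = Suc j mod l then 1 else 0)))"

definition contains_linear_cycle :: "nat \<Rightarrow> 'a set \<Rightarrow> 'a set set \<Rightarrow> nat \<Rightarrow> bool" where
  "contains_linear_cycle r V E l \<longleftrightarrow> (\<exists>W C. W \<subseteq> V \<and> C \<subseteq> E \<and> linear_cycle r l W C)"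

end

theory Submission
  imports Defs
begin

text \<open>Pass to a subhypergraph of minimum degree at least \<open>d / r\<close> and grow a linear tree from a vertex of
  maximum degree, level by level. Levels are measured by volume, the sum of the degrees. In each
  tree edge only one vertex of maximum degree is allowed to branch further, so the edges meeting
  older levels are negligible among those meeting the current level. If the volume does not grow
  by the factor \<open>K = d / (32 k r^4)\<close>, the edges leaving the level are dense between the level and
  few vertices. A bipartite core of these edges has minimum degree at least \<open>8 k r\<close>, and linear
  paths in it can be extended greedily. Some right-hand vertex \<open>w\<close> of the core has two neighbours
  \<open>a\<close> and \<open>a'\<close> on different branches, and a path of any odd length \<open>2 t - 1\<close> from \<open>w\<close> ends at
  a vertex whose branch differs from that of \<open>a\<close> or from that of \<open>a'\<close>. Adding the edge from \<open>w\<close> to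
  that neighbour and the two branches of length \<open>h\<close> gives a cycle of length \<open>2 h + 2 t\<close>.\<close>

section \<open>Linear paths and cycles\<close>

text \<open>The vertex \<open>v\<close> is where the path leaves its first edge. Requiring only that
  the remaining edges meet \<open>e\<close> inside \<open>{v}\<close> also covers the last edge,
  after which nothing remains and \<open>v\<close> is \<open>y\<close>.\<close>

fun lpath :: "'a \<Rightarrow> 'a set list \<Rightarrow> 'a \<Rightarrow> bool" where
  "lpath x [] y \<longleftrightarrow> x = y"
| "lpath x (e # es) y \<longleftrightarrow>
     (\<exists>v. x \<in> e \<and> v \<in> e \<and> x \<noteq> v \<and> e \<inter> \<Union>(set es) \<subseteq> {v} \<and> lpath v es y)"

lemma lpath_start_in: "lpath x es y \<Longrightarrow> es \<noteq> [] \<Longrightarrow> x \<in> \<Union>(set es)"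
  by (cases es) auto

lemma lpath_end_in: "lpath x es y \<Longrightarrow> es \<noteq> [] \<Longrightarrow> y \<in> \<Union>(set es)"
proof (induction es arbitrary: x)
  case (Cons e es)
  then show ?case by (cases es) auto
qed simp

text \<open>The first edge of \<open>es\<close> contains the junction \<open>y\<close> only if the
  path leaves it there, so attaching \<open>fs\<close> creates no intersection outside
  \<open>v\<close>.\<close>

lemma lpath_append:
  assumes "lpath x es y" "lpath y fs z" "\<Union>(set es) \<inter> \<Union>(set fs) \<subseteq> {y}"
  shows "lpath x (es @ fs) z"
  using assms
proof (induction es arbitrary: x)
  case (Cons e es)
  then obtain v where v: "x \<in> e" "v \<in> e" "x \<noteq> v" "e \<inter> \<Union>(set es) \<subseteq> {v}" "lpath v es y"
    by auto
  have "y = v" if "y \<in> e"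
    using that v(4,5) lpath_end_in[OF v(5)] by (cases "es = []") auto
  then have "e \<inter> \<Union>(set (es @ fs)) \<subseteq> {v}"
    using v(4) Cons.prems(3) by auto
  moreover have "lpath v (es @ fs) z"
    using Cons.IH[OF v(5)] Cons.prems by auto
  ultimately show ?case using v by auto
qed simp

lemma lpath_rev: "lpath x es y \<Longrightarrow> lpath y (rev es) x"
proof (induction es arbitrary: x)
  case (Cons e es)
  then obtain v where v: "x \<in> e" "v \<in> e" "x \<noteq> v" "e \<inter> \<Union>(set es) \<subseteq> {v}" "lpath v es y"
    by auto
  have "lpath y (rev es @ [e]) x"
    by (rule lpath_append[OF Cons.IH[OF v(5)]]) (use v in auto)
  then show ?case by simp
qed simp

lemma lpath_nth_inter:
  assumes "lpath x es y" "i < j" "j < length es"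
  shows "card (es ! i \<inter> es ! j) = (if j = Suc i then 1 else 0)"
  using assms
proof (induction es arbitrary: x i j)
  case (Cons e es)
  then obtain v where v: "x \<in> e" "v \<in> e" "x \<noteq> v" "e \<inter> \<Union>(set es) \<subseteq> {v}" "lpath v es y"
    by auto
  obtain j' where j': "j = Suc j'" using Cons.prems(2) by (cases j) auto
  show ?case
  proof (cases i)
    case (Suc i')
    then show ?thesis using Cons.IH[OF v(5), of i' j'] Cons.prems j' by auto
  next
    case 0
    obtain f fs where f: "es = f # fs" using Cons.prems j' by (cases es) auto
    obtain v' where v': "v \<in> f" "v \<noteq> v'" "f \<inter> \<Union>(set fs) \<subseteq> {v'}"
      using v(5) f by auto
    show ?thesis
    proof (cases j')
      case z: 0
      have "e \<inter> f = {v}" using v v' f by auto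
      then show ?thesis using 0 z f j' by simp
    next
      case (Suc j'')
      \<comment> \<open>The path enters \<open>f\<close> at \<open>v\<close> and leaves it
        elsewhere, so \<open>v\<close> lies in no edge after \<open>f\<close>.\<close>
      then have m: "fs ! j'' \<in> set fs" using Cons.prems j' f by auto
      then have "e \<inter> fs ! j'' \<subseteq> {v}" using v(4) f by auto
      moreover have "v \<notin> fs ! j''" using v' m by auto
      ultimately have "e \<inter> fs ! j'' = {}" by auto
      then show ?thesis using 0 Suc f j' by simp
    qed
  qed
qed simp

lemma lpath_start_nth:
  assumes "lpath x es y" "i < length es"
  shows "x \<in> es ! i \<longleftrightarrow> i = 0"
proof (cases es)
  case (Cons e fs)
  then obtain v where "x \<in> e" "x \<noteq> v" "e \<inter> \<Union>(set fs) \<subseteq> {v}"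
    using assms(1) by auto
  moreover have "fs ! (i - 1) \<in> set fs" if "i \<noteq> 0"
    using that assms(2) Cons by auto
  ultimately show ?thesis using Cons by (cases i) auto
qed (use assms in simp)

lemma lpath_end_nth:
  assumes "lpath x es y" "i < length es"
  shows "y \<in> es ! i \<longleftrightarrow> Suc i = length es"
proof -
  have "y \<in> rev es ! (length es - Suc i) \<longleftrightarrow> length es - Suc i = 0"
    using lpath_start_nth[OF lpath_rev[OF assms(1)], of "length es - Suc i"] assms(2) by simp
  then show ?thesis using assms(2) by (auto simp: rev_nth)
qed

text \<open>Each edge shares one vertex with the rest of the path and contributes
  \<open>r - 1\<close> others. Inserting \<open>x\<close> makes the count right for the empty path
  as well.\<close>

lemma lpath_card_Union:
  assumes "lpath x es y" "\<And>e. e \<in> set es \<Longrightarrow> card e = r" "r \<ge> 1"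
  shows "card (insert x (\<Union>(set es))) = (r - 1) * length es + 1"
  using assms
proof (induction es arbitrary: x)
  case (Cons e es)
  then obtain v where v: "x \<in> e" "v \<in> e" "x \<noteq> v" "e \<inter> \<Union>(set es) \<subseteq> {v}" "lpath v es y"
    by auto
  have fin: "finite f" if "f \<in> set (e # es)" for f
    using Cons.prems(2)[OF that] Cons.prems(3) card.infinite by fastforce
  have "insert x (\<Union>(set (e # es))) = e \<union> insert v (\<Union>(set es))" using v by auto
  moreover have "e \<inter> insert v (\<Union>(set es)) = {v}" using v by auto
  moreover have "card (e \<union> insert v (\<Union>(set es))) + card (e \<inter> insert v (\<Union>(set es)))
      = card e + card (insert v (\<Union>(set es)))"
    using fin by (intro card_Un_Int[symmetric]) auto
  ultimately show ?case
    using Cons.IH[OF v(5)] Cons.prems by (cases r) simp_all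
qed simp

text \<open>The new edge shares two vertices with the path, so the vertex count
  \<open>(r - 1) * m + 1\<close> of \<open>m\<close> edges grows by \<open>r - 2\<close> to
  \<open>(r - 1) * (m + 1)\<close>. It meets only the first and the last edge, since the ends of the
  path lie in no other.\<close>

lemma linear_cycle_close:
  assumes p: "lpath x es y" and len: "length es \<ge> 3"
    and cr: "\<And>f. f \<in> set es \<Longrightarrow> card f = r" and ce: "card e = r" and r: "r \<ge> 3"
    and e: "e \<inter> \<Union>(set es) = {x, y}" and "x \<noteq> y"
  shows "linear_cycle r (Suc (length es)) (\<Union>(set (es @ [e]))) (set (es @ [e]))"
proof -
  let ?l = "Suc (length es)" and ?c = "es @ [e]"
  have fin: "finite f" if "f \<in> set ?c" for f
    using that cr ce r card.infinite[of f] by fastforce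
  have ne: "es \<noteq> []" using len by auto
  have "card (\<Union>(set es)) = (r - 1) * length es + 1"
    using lpath_card_Union[OF p cr] r lpath_start_in[OF p ne] by (simp add: insert_absorb)
  moreover have "card (e \<union> \<Union>(set es)) + card (e \<inter> \<Union>(set es)) = card e + card (\<Union>(set es))"
    using fin by (intro card_Un_Int[symmetric]) auto
  moreover have "card (e \<inter> \<Union>(set es)) = 2" using e \<open>x \<noteq> y\<close> by simp
  ultimately have "card (e \<union> \<Union>(set es)) = (r - 1) * ?l"
    using ce r by (auto simp: algebra_simps)
  then have cW: "card (\<Union>(set ?c)) = (r - 1) * ?l" by simp
  have last: "e \<inter> es ! i = (if i = 0 then {x} else if Suc i = length es then {y} else {})"
    if "i < length es" for i
  proof -
    have "e \<inter> es ! i = {x, y} \<inter> es ! i" using e that nth_mem[OF that] by blast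
    then show ?thesis
      using lpath_start_nth[OF p that] lpath_end_nth[OF p that] len by auto
  qed
  have int': "card (?c ! i \<inter> ?c ! j) = (if j = Suc i mod ?l \<or> i = Suc j mod ?l then 1 else 0)"
    if ij: "i < j" "j < ?l" for i j
  proof (cases "j = length es")
    case True
    then show ?thesis using ij last[of i] len by (auto simp: nth_append Int_commute)
  next
    case False
    then show ?thesis using ij lpath_nth_inter[OF p ij(1)] by (auto simp: nth_append)
  qed
  have int: "card (?c ! i \<inter> ?c ! j) = (if j = Suc i mod ?l \<or> i = Suc j mod ?l then 1 else 0)"
    if "i < ?l" "j < ?l" "i \<noteq> j" for i j
    using int'[of i j] int'[of j i] that by (cases "i < j") (auto simp: Int_commute)
  have ca: "card (?c ! i) = r" if "i < ?l" for i
    using that cr ce by (auto simp: nth_append)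
  have "distinct ?c"
    unfolding distinct_conv_nth
  proof (intro allI impI)
    fix i j assume ij: "i < length ?c" "j < length ?c" "i \<noteq> j"
    then have "card (?c ! i \<inter> ?c ! j) \<le> 1" using int[of i j] by simp
    then show "?c ! i \<noteq> ?c ! j" using ca[of i] ij r by auto
  qed
  then have "bij_betw ((!) ?c) {..<?l} (set ?c)"
    using bij_betw_nth[of ?c] by simp
  moreover have "r_graph r (\<Union>(set ?c)) (set ?c)"
    unfolding r_graph_def using fin cr ce by auto
  ultimately show ?thesis
    unfolding linear_cycle_def using cW int len by (intro conjI exI[of _ "(!) ?c"]) auto
qed

text \<open>The first edge \<open>e\<close> of \<open>fs\<close> is set aside. The rest of
  \<open>fs\<close> followed by the reverse of \<open>es\<close> is a linear path from
  \<open>v\<close> to \<open>x\<close>, and \<open>e\<close> meets it exactly in these two vertices,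
  so \<open>e\<close> closes it.\<close>

lemma linear_cycle_two_paths:
  assumes p: "lpath x es y" and q: "lpath x fs y" and xy: "x \<noteq> y"
    and int: "\<Union>(set es) \<inter> \<Union>(set fs) \<subseteq> {x, y}"
    and cr: "\<And>f. f \<in> set es \<union> set fs \<Longrightarrow> card f = r" and r: "r \<ge> 3"
    and len: "length es + length fs \<ge> 4"
  shows "linear_cycle r (length es + length fs) (\<Union>(set es \<union> set fs)) (set es \<union> set fs)"
proof -
  obtain e gs where fs: "fs = e # gs" using q xy by (cases fs) auto
  obtain v where v: "x \<in> e" "v \<in> e" "x \<noteq> v" "e \<inter> \<Union>(set gs) \<subseteq> {v}" "lpath v gs y"
    using q fs by auto
  have es: "es \<noteq> []" using p xy by auto
  have ye: "y = v" if "y \<in> e"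
    using that v(4,5) lpath_end_in[OF v(5)] by (cases "gs = []") auto
  have xg: "x \<notin> \<Union>(set gs)" using v by auto
  have P: "lpath v (gs @ rev es) x"
    by (rule lpath_append[OF v(5) lpath_rev[OF p]]) (use int fs xg in auto)
  have vin: "v \<in> \<Union>(set (gs @ rev es))"
    using lpath_start_in[OF P] es by simp
  have "x \<in> \<Union>(set es)" using lpath_start_in[OF p es] .
  then have "e \<inter> \<Union>(set (gs @ rev es)) = {v, x}"
    using v(1,2,4) ye int fs vin by auto
  then have "linear_cycle r (Suc (length (gs @ rev es)))
      (\<Union>(set ((gs @ rev es) @ [e]))) (set ((gs @ rev es) @ [e]))"
    using v(3) cr r len fs by (intro linear_cycle_close[OF P]) auto
  moreover have "set ((gs @ rev es) @ [e]) = set es \<union> set fs" using fs by auto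
  moreover have "Suc (length (gs @ rev es)) = length es + length fs" using fs by simp
  ultimately show ?thesis by metis
qed

section \<open>Trees with levels\<close>

locale linear_r_graph =
  fixes r :: nat and E :: "'a set set"
  assumes r3: "r \<ge> 3" and finE: "finite E"
    and card_edge: "e \<in> E \<Longrightarrow> card e = r"
    and lin: "e \<in> E \<Longrightarrow> f \<in> E \<Longrightarrow> e \<noteq> f \<Longrightarrow> card (e \<inter> f) \<le> 1"
begin

lemma finite_edge: "e \<in> E \<Longrightarrow> finite e"
  using card_edge r3 card.infinite by fastforce

lemma edge_inter_single:
  assumes "e \<in> E" "f \<in> E" "e \<noteq> f" "v \<in> e" "v \<in> f"
  shows "e \<inter> f = {v}"
proof -
  have "card (e \<inter> f) \<le> Suc 0" using lin assms by simp
  moreover have "finite (e \<inter> f)" using finite_edge assms(1) by simp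
  ultimately have "\<forall>u\<in>e \<inter> f. \<forall>w\<in>e \<inter> f. u = w"
    using card_le_Suc0_iff_eq by blast
  then show ?thesis using assms(4,5) by blast
qed

lemma edge_eqI:
  assumes "e \<in> E" "f \<in> E" "u \<in> e \<inter> f" "v \<in> e \<inter> f" "u \<noteq> v"
  shows "e = f"
proof (rule ccontr)
  assume "e \<noteq> f"
  then have "e \<inter> f = {u}" using edge_inter_single[OF assms(1,2)] assms(3) by simp
  then show False using assms(4,5) by simp
qed

end

text \<open>The \<open>n\<close> tree edges passed when climbing from \<open>a\<close> through
  \<open>par\<close>, starting with the edge at \<open>a\<close>.\<close>

fun chain :: "('a \<Rightarrow> 'a set) \<Rightarrow> ('a \<Rightarrow> 'a) \<Rightarrow> nat \<Rightarrow> 'a \<Rightarrow> 'a set list" where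
  "chain G par 0 a = []"
| "chain G par (Suc n) a = G a # chain G par n (par a)"

lemma length_chain [simp]: "length (chain G par n a) = n"
  by (induction n arbitrary: a) auto

text \<open>\<open>L s\<close> is the set of branching vertices on level \<open>s\<close>, and \<open>B s\<close> consists of all vertices of the
  tree edges strictly below level \<open>s\<close>. A tree edge \<open>G u\<close> contains only one branching vertex
  besides the parent of \<open>u\<close>, so that two descending branches always part at a vertex and
  never inside an edge.\<close>

locale level_tree = linear_r_graph r E
  for r :: nat and E :: "'a set set" +
  fixes x :: 'a and i :: nat and L B :: "nat \<Rightarrow> 'a set"
    and par :: "'a \<Rightarrow> 'a" and G :: "'a \<Rightarrow> 'a set"
  assumes L0: "L 0 = {x}" and B0: "B 0 = {}" and B1: "B (Suc 0) = {x}"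
    and L_sub: "s \<le> i \<Longrightarrow> L s \<subseteq> B (Suc s)"
    and L_disj: "s \<le> i \<Longrightarrow> L s \<inter> B s = {}"
    and B_Suc: "s \<le> i \<Longrightarrow> B s \<subseteq> B (Suc s)"
    and par_in: "s < i \<Longrightarrow> u \<in> L (Suc s) \<Longrightarrow> par u \<in> L s"
    and G_edge: "s < i \<Longrightarrow> u \<in> L (Suc s) \<Longrightarrow> G u \<in> E"
    and G_self: "s < i \<Longrightarrow> u \<in> L (Suc s) \<Longrightarrow> u \<in> G u"
    and G_sub: "s < i \<Longrightarrow> u \<in> L (Suc s) \<Longrightarrow> G u \<subseteq> B (Suc (Suc s))"
    and G_inter: "s < i \<Longrightarrow> u \<in> L (Suc s) \<Longrightarrow> G u \<inter> B (Suc s) = {par u}"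
    and G_disj: "s < i \<Longrightarrow> u \<in> L (Suc s) \<Longrightarrow> u' \<in> L (Suc s) \<Longrightarrow> u \<noteq> u' \<Longrightarrow>
          G u \<inter> G u' \<subseteq> B (Suc s)"
begin

lemma B_mono: "s \<le> s' \<Longrightarrow> s' \<le> Suc i \<Longrightarrow> B s \<subseteq> B s'"
proof (induction s' rule: dec_induct)
  case (step m)
  then show ?case using B_Suc[of m] by auto
qed simp

lemma par_pow_in: "a \<in> L s \<Longrightarrow> n \<le> s \<Longrightarrow> s \<le> i \<Longrightarrow> (par ^^ n) a \<in> L (s - n)"
proof (induction n)
  case (Suc n)
  then have "(par ^^ n) a \<in> L (Suc (s - Suc n))"
    by (simp add: Suc_diff_Suc)
  then show ?case using par_in[of "s - Suc n"] Suc.prems by auto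
qed simp

lemma chain_edges:
  "a \<in> L s \<Longrightarrow> n \<le> s \<Longrightarrow> s \<le> i \<Longrightarrow> set (chain G par n a) \<subseteq> E"
proof (induction n arbitrary: a s)
  case (Suc n)
  then obtain s' where "s = Suc s'" by (cases s) auto
  then show ?case using Suc G_edge[of s' a] par_in[of s' a] by auto
qed simp

lemma chain_sub:
  "a \<in> L s \<Longrightarrow> n \<le> s \<Longrightarrow> s \<le> i \<Longrightarrow> \<Union>(set (chain G par n a)) \<subseteq> B (Suc s)"
proof (induction n arbitrary: a s)
  case (Suc n)
  then obtain s' where s: "s = Suc s'" by (cases s) auto
  have "\<Union>(set (chain G par n (par a))) \<subseteq> B (Suc s')"
    using Suc s par_in[of s' a] by auto
  then show ?case using Suc.prems s G_sub[of s' a] B_Suc[of s] by auto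
qed simp

text \<open>If \<open>a\<close> is on level \<open>s\<close>, then \<open>G a\<close> meets
  \<open>B s\<close> only in \<open>par a\<close>, while the later edges of the chain lie in
  \<open>B s\<close>.\<close>

lemma lpath_chain:
  "a \<in> L s \<Longrightarrow> n \<le> s \<Longrightarrow> s \<le> i \<Longrightarrow> lpath a (chain G par n a) ((par ^^ n) a)"
proof (induction n arbitrary: a s)
  case (Suc n)
  then obtain s' where s: "s = Suc s'" by (cases s) auto
  have p: "par a \<in> L s'" and lt: "s' < i" using Suc s par_in[of s' a] by auto
  have "\<Union>(set (chain G par n (par a))) \<subseteq> B (Suc s')"
    using chain_sub[OF p, of n] Suc.prems s by auto
  moreover have "G a \<inter> B (Suc s') = {par a}" "a \<in> G a"
    using G_inter[OF lt] G_self[OF lt] Suc.prems s by auto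
  moreover have "a \<noteq> par a"
    using L_disj[of s] p L_sub[of s'] Suc.prems s by auto
  moreover have "lpath (par a) (chain G par n (par a)) ((par ^^ n) (par a))"
    using Suc p s by auto
  ultimately show ?case by (auto simp: funpow_swap1)
qed simp

lemma G_level:
  assumes "s < i" "u \<in> L (Suc s)" "u' \<in> L (Suc s)" "u' \<in> G u"
  shows "u' = u"
proof (rule ccontr)
  assume "u' \<noteq> u"
  then have "u' \<in> B (Suc s)"
    using G_disj[OF assms(1,2,3)] G_self[OF assms(1,3)] assms(4) by auto
  then show False using L_disj[of "Suc s"] assms by auto
qed

lemma chain_level:
  assumes "a \<in> L s" "n \<le> s" "s \<le> i"
  shows "\<Union>(set (chain G par n a)) \<inter> L s \<subseteq> {a}"
proof (cases n)
  case (Suc m)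
  then obtain s' where s: "s = Suc s'" using assms by (cases s) auto
  have "\<Union>(set (chain G par m (par a))) \<subseteq> B s"
    using chain_sub[of "par a" s' m] par_in[of s' a] assms s Suc by auto
  then show ?thesis using L_disj[of s] G_level[of s' a] assms s Suc by auto
qed simp

text \<open>Tree edges of one level meet only in older vertices, and \<open>par a\<close> is the
  only such vertex in \<open>G a\<close>; this settles single edges. In the induction step the first
  edges add no intersection, because their only older vertices \<open>par a\<close> and
  \<open>par b\<close> differ and neither lies on the other chain.\<close>

lemma chain_disj:
  assumes "a \<in> L s" "b \<in> L s" "Suc n \<le> s" "s \<le> i" "(par ^^ n) a \<noteq> (par ^^ n) b"
  shows "\<Union>(set (chain G par (Suc n) a)) \<inter> \<Union>(set (chain G par (Suc n) b)) \<subseteq> {(par ^^ Suc n) a}"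
  using assms
proof (induction n arbitrary: a b s)
  case 0
  then obtain s' where s: "s = Suc s'" by (cases s) auto
  then have "G a \<inter> G b \<subseteq> B (Suc s')" "G a \<inter> B (Suc s') = {par a}"
    using G_disj[of s' a b] G_inter[of s' a] 0 by auto
  then show ?case by auto
next
  case (Suc n)
  then obtain s' where s: "s = Suc s'" by (cases s) auto
  let ?C = "\<lambda>a. \<Union>(set (chain G par (Suc n) (par a)))"
  have lt: "s' < i" and p: "par a \<in> L s'" "par b \<in> L s'" using par_in Suc.prems s by auto
  have ne: "(par ^^ n) (par a) \<noteq> (par ^^ n) (par b)" using Suc.prems(5) by (simp add: funpow_swap1)
  have IH: "?C a \<inter> ?C b \<subseteq> {(par ^^ Suc n) (par a)}"
    using Suc.IH[OF p _ _ ne] Suc.prems s by auto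
  have "par a \<noteq> par b" using ne by auto
  then have ab: "a \<noteq> b" by auto
  have Gab: "G a \<inter> G b \<subseteq> B s" "G a \<inter> B s \<subseteq> {par a}" "G b \<inter> B s \<subseteq> {par b}"
    using G_disj[OF lt _ _ ab] G_inter[OF lt] Suc.prems s by auto
  have sub: "?C a \<subseteq> B s" "?C b \<subseteq> B s"
    using chain_sub[OF p(1), of "Suc n"] chain_sub[OF p(2), of "Suc n"] Suc.prems s by auto
  have lev: "?C a \<inter> L s' \<subseteq> {par a}" "?C b \<inter> L s' \<subseteq> {par b}"
    using chain_level[OF p(1), of "Suc n"] chain_level[OF p(2), of "Suc n"] Suc.prems s by auto
  have "G a \<inter> G b = {}"
  proof (rule ccontr)
    assume "G a \<inter> G b \<noteq> {}"
    then obtain v where "v \<in> G a" "v \<in> G b" by auto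
    then have "v = par a" "v = par b" using Gab by auto
    then show False using \<open>par a \<noteq> par b\<close> by simp
  qed
  moreover have cross: "G u \<inter> D = {}"
    if "G u \<inter> B s \<subseteq> {par u}" "D \<subseteq> B s" "D \<inter> L s' \<subseteq> {par v}" "par u \<in> L s'" "par u \<noteq> par v"
    for u v D
  proof (rule ccontr)
    assume "G u \<inter> D \<noteq> {}"
    then obtain w where "w \<in> G u" "w \<in> D" by auto
    then have "w = par u" "w \<in> D" using that(1,2) by auto
    then show False using that(3,4,5) by auto
  qed
  have "G a \<inter> ?C b = {}" "G b \<inter> ?C a = {}"
    using cross[OF Gab(2) sub(2) lev(2) p(1)] cross[OF Gab(3) sub(1) lev(1) p(2)]
      \<open>par a \<noteq> par b\<close> by simp_all
  ultimately have "(G a \<union> ?C a) \<inter> (G b \<union> ?C b) = ?C a \<inter> ?C b"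
    by (simp add: Int_Un_distrib Int_Un_distrib2 Int_commute)
  then have "(G a \<union> ?C a) \<inter> (G b \<union> ?C b) \<subseteq> {(par ^^ Suc n) (par a)}"
    using IH by simp
  then show ?case by (simp add: funpow_swap1)
qed

end

section \<open>Cycles from a dense level\<close>

text \<open>Choosing a point of \<open>S a \<inter> X\<close> is injective by disjointness. In the
  greedy extensions this bounds the number of edges blocked by a forbidden set.\<close>

lemma card_meeting_le:
  assumes "finite X" "\<And>a b. a \<in> A \<Longrightarrow> b \<in> A \<Longrightarrow> a \<noteq> b \<Longrightarrow> S a \<inter> S b = {}"
  shows "card {a \<in> A. S a \<inter> X \<noteq> {}} \<le> card X"
proof -
  define g where "g a = (SOME v. v \<in> S a \<inter> X)" for a
  have g: "g a \<in> S a \<inter> X" if ne: "S a \<inter> X \<noteq> {}" for a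
  proof -
    obtain v where "v \<in> S a \<inter> X" using ne by auto
    then show ?thesis unfolding g_def by (rule someI)
  qed
  show ?thesis
  proof (rule card_inj_on_le[of g])
    show "inj_on g {a \<in> A. S a \<inter> X \<noteq> {}}"
    proof (rule inj_onI)
      fix a b assume "a \<in> {a \<in> A. S a \<inter> X \<noteq> {}}" "b \<in> {a \<in> A. S a \<inter> X \<noteq> {}}" "g a = g b"
      then show "a = b" using g[of a] g[of b] assms(2)[of a b] by auto
    qed
  qed (use g assms(1) in auto)
qed

text \<open>\<open>F\<close> serves as a bipartite graph in which the hyperedge \<open>e\<close>
  joins the left vertex \<open>lam e\<close> to the right vertex \<open>rho e\<close>. Degrees are
  sizes of fibres of \<open>lam\<close> and of \<open>rho\<close>, so a vertex may occur on both
  sides.\<close>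

locale dense_level = level_tree r E x i L B par G
  for r :: nat and E :: "'a set set" and x i L B par G +
  fixes F :: "'a set set" and lam rho :: "'a set \<Rightarrow> 'a" and k :: nat
  assumes k2: "k \<ge> 2" and F_sub: "F \<subseteq> E" and F_ne: "F \<noteq> {}"
    and F_avoid: "e \<in> F \<Longrightarrow> e \<inter> B i = {}"
    and lam_in: "e \<in> F \<Longrightarrow> lam e \<in> e" and lam_L: "e \<in> F \<Longrightarrow> lam e \<in> L i"
    and rho_in: "e \<in> F \<Longrightarrow> rho e \<in> e" and rho_lam: "e \<in> F \<Longrightarrow> rho e \<noteq> lam e"
    and lam_deg: "e \<in> F \<Longrightarrow> card {f \<in> F. lam f = lam e} \<ge> 8 * k * r"
    and rho_deg: "e \<in> F \<Longrightarrow> card {f \<in> F. rho f = rho e} \<ge> 8 * k * r"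
begin

lemma finF: "finite F"
  using F_sub finE finite_subset by blast

lemma lam_inj: "e \<in> F \<Longrightarrow> f \<in> F \<Longrightarrow> rho e = rho f \<Longrightarrow> lam e = lam f \<Longrightarrow> e = f"
  using edge_eqI[of e f "lam e" "rho e"] F_sub lam_in[of e] lam_in[of f] rho_in[of e] rho_in[of f]
    rho_lam[of e] by auto

lemma rho_other:
  assumes "e \<in> F"
  obtains f where "f \<in> F" "rho f = rho e" "lam f \<noteq> lam e"
proof -
  have "8 * k * r > 1" using k2 r3 by (cases k; cases r) auto
  then have "card {f \<in> F. rho f = rho e} > 1" using rho_deg[OF assms] by linarith
  then have "\<not> {f \<in> F. rho f = rho e} \<subseteq> {e}"
    using card_mono[of "{e}" "{f \<in> F. rho f = rho e}"] by auto
  then obtain f where "f \<in> F" "rho f = rho e" "f \<noteq> e" by auto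
  then show ?thesis using that lam_inj[of f e] assms by auto
qed

lemma i_pos: "i > 0"
proof (rule ccontr)
  assume "\<not> i > 0"
  then have l: "lam e = x" if "e \<in> F" for e using lam_L[OF that] L0 by auto
  obtain e where "e \<in> F" using F_ne by auto
  then show False using rho_other[of e] l by metis
qed

lemma G_lam_disj:
  assumes "e \<in> F" "f \<in> F" "lam e \<noteq> lam f"
  shows "(G (lam e) - B i) \<inter> (G (lam f) - B i) = {}"
proof -
  obtain s where "i = Suc s" using i_pos by (cases i) auto
  then show ?thesis using G_disj[of s "lam e" "lam f"] lam_L assms by auto
qed

lemma G_last:
  assumes "a \<in> L i"
  shows "G a \<in> E" "a \<in> G a" "G a \<inter> B i = {par a}"
  using assms i_pos G_edge[of "i - 1" a] G_self[of "i - 1" a] G_inter[of "i - 1" a] by auto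

text \<open>The edges of \<open>F\<close> at \<open>rho e\<close> are disjoint elsewhere, so at most
  \<open>card X\<close> of them meet \<open>X\<close>. Their tree edges \<open>G (lam f)\<close> are
  disjoint outside \<open>B i\<close>, so at most \<open>card X'\<close> are spoilt by
  \<open>X'\<close>. The degree exceeds the sum. Control of \<open>G (lam f)\<close> later lets a
  branch leave the path cleanly at \<open>lam f\<close>.\<close>

lemma extend_to_lam:
  assumes e: "e \<in> F" and fin: "finite X" "finite X'" and "rho e \<notin> X"
    and card: "card X + card X' < 8 * k * r"
  shows "\<exists>f\<in>F. rho f = rho e \<and> f \<inter> X = {} \<and> G (lam f) \<inter> X' \<subseteq> B i"
proof (rule ccontr)
  assume no: "\<not> ?thesis"
  let ?A = "{f \<in> F. rho f = rho e}"
  let ?X = "{f \<in> ?A. (f - {rho e}) \<inter> X \<noteq> {}}" and ?X' = "{f \<in> ?A. (G (lam f) - B i) \<inter> X' \<noteq> {}}"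
  have "card ?X \<le> card X"
  proof (rule card_meeting_le[OF fin(1)])
    fix a b assume ab: "a \<in> ?A" "b \<in> ?A" "a \<noteq> b"
    then have "a \<inter> b = {rho e}"
      using F_sub rho_in by (intro edge_inter_single) force+
    then show "(a - {rho e}) \<inter> (b - {rho e}) = {}" by auto
  qed
  moreover have "card ?X' \<le> card X'"
  proof (rule card_meeting_le[OF fin(2)])
    fix a b assume "a \<in> ?A" "b \<in> ?A" "a \<noteq> b"
    then show "(G (lam a) - B i) \<inter> (G (lam b) - B i) = {}"
      using lam_inj[of a b] by (intro G_lam_disj) auto
  qed
  moreover have "?A \<subseteq> ?X \<union> ?X'" using no assms(4) by blast
  then have "card ?A \<le> card (?X \<union> ?X')" using finF by (intro card_mono) auto
  then have "card ?A \<le> card ?X + card ?X'" using card_Un_le le_trans by blast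
  ultimately show False using rho_deg[OF e] card by linarith
qed

lemma extend_to_rho:
  assumes e: "e \<in> F" and fin: "finite X" and "lam e \<notin> X" and card: "card X < 8 * k * r"
  shows "\<exists>f\<in>F. lam f = lam e \<and> f \<inter> X = {}"
proof (rule ccontr)
  assume no: "\<not> ?thesis"
  let ?A = "{f \<in> F. lam f = lam e}"
  let ?X = "{f \<in> ?A. (f - {lam e}) \<inter> X \<noteq> {}}"
  have "card ?X \<le> card X"
  proof (rule card_meeting_le[OF fin(1)])
    fix a b assume ab: "a \<in> ?A" "b \<in> ?A" "a \<noteq> b"
    then have "a \<inter> b = {lam e}"
      using F_sub lam_in by (intro edge_inter_single) force+
    then show "(a - {lam e}) \<inter> (b - {lam e}) = {}" by auto
  qed
  moreover have "?A \<subseteq> ?X" using no assms(3) by blast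
  then have "card ?A \<le> card ?X" using finF by (intro card_mono) auto
  ultimately show False using lam_deg[OF e] card by linarith
qed

text \<open>Choosing a right-hand vertex whose neighbours meet as far down the tree as possible makes
  all paths of \<open>F\<close> starting there stay below the same vertex of level \<open>i - h\<close>.\<close>

definition confined :: "nat \<Rightarrow> bool" where
  "confined h \<longleftrightarrow> (\<forall>f\<in>F. \<forall>f'\<in>F. rho f = rho f' \<longrightarrow> (par ^^ h) (lam f) = (par ^^ h) (lam f'))"

text \<open>For a right vertex \<open>w\<close>, \<open>h w\<close> counts the steps after which its
  left neighbours have a common ancestor; the root gives the bound \<open>i\<close>. Where the
  largest value \<open>H\<close> is attained, two neighbours are still apart after
  \<open>H - 1\<close> steps, while \<open>H\<close> steps suffice at every right vertex.\<close>

lemma highest_join: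
  obtains h e e' where "1 \<le> h" "h \<le> i" "e \<in> F" "e' \<in> F" "rho e = rho e'"
    "(par ^^ (h - 1)) (lam e) \<noteq> (par ^^ (h - 1)) (lam e')" "confined h"
proof -
  define P where "P n w \<longleftrightarrow> (\<forall>f\<in>F. \<forall>f'\<in>F. rho f = w \<longrightarrow> rho f' = w \<longrightarrow>
      (par ^^ n) (lam f) = (par ^^ n) (lam f'))" for n w
  define h where "h w = (LEAST n. P n w)" for w
  have "(par ^^ i) (lam f) = x" if "f \<in> F" for f
    using par_pow_in[OF lam_L[OF that], of i] L0 by auto
  then have Pi: "P i w" for w unfolding P_def by auto
  then have hi: "h w \<le> i" and Ph: "P (h w) w" for w
    unfolding h_def
    using Least_le[of "\<lambda>n. P n w" i] LeastI[of "\<lambda>n. P n w" i] by auto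
  have mono: "P m w" if "P n w" "n \<le> m" for n m w
  proof -
    have "(par ^^ m) a = (par ^^ (m - n)) ((par ^^ n) a)" for a
      using that(2) by (metis comp_apply funpow_add le_add_diff_inverse2)
    then show ?thesis using that(1) unfolding P_def by metis
  qed
  define H where "H = Max (h ` rho ` F)"
  have "H \<in> h ` rho ` F" unfolding H_def using finF F_ne by (intro Max_in) auto
  then obtain e0 where e0: "e0 \<in> F" "h (rho e0) = H" by auto
  have "h (rho f) \<le> H" if "f \<in> F" for f
    unfolding H_def using finF that by (intro Max_ge) auto
  then have all: "P H (rho f)" if "f \<in> F" for f using that mono[OF Ph] by auto
  obtain e1 where "e1 \<in> F" "rho e1 = rho e0" "lam e1 \<noteq> lam e0" using rho_other[OF e0(1)] .
  then have "\<not> P 0 (rho e0)" using e0 unfolding P_def by auto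
  then have H1: "1 \<le> H" using Ph[of "rho e0"] e0 by (cases H) auto
  then have "\<not> P (H - 1) (rho e0)"
    using e0 not_less_Least[of "H - 1" "\<lambda>n. P n (rho e0)"] unfolding h_def by auto
  then obtain e e' where "e \<in> F" "e' \<in> F" "rho e = rho e0" "rho e' = rho e0"
    "(par ^^ (H - 1)) (lam e) \<noteq> (par ^^ (H - 1)) (lam e')"
    unfolding P_def by blast
  moreover have "H \<le> i" using hi[of "rho e0"] e0 by simp
  moreover have "confined H" using all unfolding P_def confined_def by metis
  ultimately show ?thesis using H1 by (intro that[of H e e']) simp_all
qed

text \<open>Together \<open>es\<close> and \<open>f\<close> form a path of odd length
  \<open>2 * t + 1\<close> from \<open>rho e0\<close> to \<open>lam f\<close>, grown greedily
  between the two sides. The \<open>h\<close>-th ancestor of the left vertices stays the same, since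
  \<open>confined h\<close> transfers it across each right vertex.\<close>

lemma alternating_path:
  assumes e0: "e0 \<in> F" and X: "finite X" "rho e0 \<notin> X" "card X \<le> 4 * r"
    and join: "confined h"
    and "t < k"
  shows "\<exists>es f. length es = 2 * t \<and> set es \<subseteq> F \<and> f \<in> F \<and> lpath (rho e0) es (rho f) \<and>
    \<Union>(set es) \<inter> \<Union>{f} \<subseteq> {rho f} \<and> (\<Union>(set es) \<union> f) \<inter> X = {} \<and>
    G (lam f) \<inter> (\<Union>(set es) \<union> insert (rho e0) X) \<subseteq> B i \<and> (par ^^ h) (lam f) = (par ^^ h) (lam e0)"
proof -
  have room: "card (\<Union>(set es) \<union> insert (rho e0) X) \<le> (length es + 4) * r + 1"
    and fin: "finite (\<Union>(set es) \<union> insert (rho e0) X)"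
    if "set es \<subseteq> F" for es
  proof -
    have "card (\<Union>(set es)) \<le> r * length es"
    proof -
      have "card (\<Union>(set es)) \<le> (\<Sum>e\<in>set es. card e)"
        by (rule card_Union_le_sum_card)
      also have "\<dots> = r * card (set es)" using that F_sub card_edge by (subst sum.cong[OF refl, of _ _ "\<lambda>_. r"]) auto
      also have "\<dots> \<le> r * length es" using card_length by auto
      finally show ?thesis .
    qed
    moreover have "card (insert (rho e0) X) \<le> 4 * r + 1" using X by (simp add: card_insert_if)
    moreover have "card (\<Union>(set es) \<union> insert (rho e0) X) \<le> card (\<Union>(set es)) + card (insert (rho e0) X)"
      by (rule card_Un_le)
    ultimately show "card (\<Union>(set es) \<union> insert (rho e0) X) \<le> (length es + 4) * r + 1"
      by (simp add: algebra_simps)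
    show "finite (\<Union>(set es) \<union> insert (rho e0) X)"
      using that F_sub finite_edge X(1) by auto
  qed
  \<comment> \<open>One step from right to left. The path and \<open>X\<close> are forbidden twice,
    for \<open>f\<close> (apart from its start \<open>rho e\<close>) and for
    \<open>G (lam f)\<close>; with at most \<open>2 * k - 2\<close> edges so far, both counts
    together stay below the degree \<open>8 * k * r\<close>.\<close>
  have half: "\<exists>f\<in>F. rho f = rho e \<and> \<Union>(set es) \<inter> \<Union>{f} \<subseteq> {rho f} \<and> (\<Union>(set es) \<union> f) \<inter> X = {} \<and>
      G (lam f) \<inter> (\<Union>(set es) \<union> insert (rho e0) X) \<subseteq> B i"
    if hyp: "e \<in> F" "set es \<subseteq> F" "length es + 2 \<le> 2 * k" "lpath (rho e0) es (rho e)" "\<Union>(set es) \<inter> X = {}" for es e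
  proof -
    let ?Y = "\<Union>(set es) \<union> insert (rho e0) X"
    have Y: "card (?Y - {rho e}) \<le> (length es + 4) * r + 1"
      by (rule le_trans[OF card_Diff1_le room[OF hyp(2)]])
    have "card (?Y - {rho e}) + card ?Y \<le> 2 * ((length es + 4) * r + 1)"
      using add_mono[OF Y room[OF hyp(2)]] by (simp only: mult_2)
    also have "\<dots> \<le> 2 * ((2 * k + 2) * r + 1)"
      using hyp(3) by (intro mult_le_mono2 add_le_mono1 mult_le_mono1) simp
    also have "\<dots> < 8 * k * r"
    proof -
      have "2 * r \<le> k * r" using k2 by simp
      moreover have "8 * k * r = 4 * (k * r) + 4 * (k * r)" "2 * ((2 * k + 2) * r + 1) = 4 * (k * r) + 4 * r + 2"
        by (simp_all add: algebra_simps)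
      ultimately show ?thesis using r3 by linarith
    qed
    finally obtain f where f: "f \<in> F" "rho f = rho e" "f \<inter> (?Y - {rho e}) = {}" "G (lam f) \<inter> ?Y \<subseteq> B i"
      using extend_to_lam[OF hyp(1), of "?Y - {rho e}" ?Y] fin[OF hyp(2)] by auto
    have "rho e \<notin> X"
      using hyp(4,5) lpath_end_in[OF hyp(4)] X(2) by (cases "es = []") auto
    then show ?thesis using f hyp(5) by (intro bexI[of _ f]) auto
  qed
  show ?thesis using \<open>t < k\<close>
  proof (induction t)
    case 0
    have "set [] \<subseteq> F" "length ([] :: 'a set list) + 2 \<le> 2 * k" "lpath (rho e0) [] (rho e0)"
      "\<Union>(set []) \<inter> X = {}"
      using k2 by simp_all
    from half[OF e0 this] obtain f where f: "f \<in> F" "rho f = rho e0"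
      "\<Union>(set []) \<inter> \<Union>{f} \<subseteq> {rho f}" "(\<Union>(set []) \<union> f) \<inter> X = {}"
      "G (lam f) \<inter> (\<Union>(set []) \<union> insert (rho e0) X) \<subseteq> B i"
      by blast
    moreover have "(par ^^ h) (lam f) = (par ^^ h) (lam e0)"
      using join f e0 unfolding confined_def by blast
    ultimately show ?case
      by (intro exI[of _ "[]"] exI[of _ f] conjI) simp_all
  next
    case (Suc t)
    then obtain es f where f: "length es = 2 * t" "set es \<subseteq> F" "f \<in> F" "lpath (rho e0) es (rho f)"
      "\<Union>(set es) \<inter> \<Union>{f} \<subseteq> {rho f}" "(\<Union>(set es) \<union> f) \<inter> X = {}"
      "G (lam f) \<inter> (\<Union>(set es) \<union> insert (rho e0) X) \<subseteq> B i" "(par ^^ h) (lam f) = (par ^^ h) (lam e0)"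
      using Suc_lessD by blast
    let ?es = "es @ [f]"
    have p: "lpath (rho e0) ?es (lam f)"
      by (rule lpath_append[OF f(4)]) (use f rho_in rho_lam lam_in in auto)
    let ?Y = "\<Union>(set ?es) \<union> insert (rho e0) X"
    have F': "set ?es \<subseteq> F" using f by auto
    have "card (?Y - {lam f}) \<le> card ?Y" by (simp add: card_Diff1_le fin[OF F'])
    also have "\<dots> \<le> (2 * t + 5) * r + 1" using room[OF F'] f(1) by (simp add: algebra_simps)
    also have "\<dots> \<le> (2 * k + 1) * r + 1"
      using Suc.prems by (intro add_le_mono1 mult_le_mono1) simp
    also have "\<dots> < 8 * k * r"
    proof -
      have "2 * r \<le> k * r" using k2 by simp
      moreover have "8 * k * r = 4 * (k * r) + 4 * (k * r)" "(2 * k + 1) * r + 1 = 2 * (k * r) + r + 1"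
        by (simp_all add: algebra_simps)
      ultimately show ?thesis using r3 by linarith
    qed
    finally obtain g where g: "g \<in> F" "lam g = lam f" "g \<inter> (?Y - {lam f}) = {}"
      using extend_to_rho[OF f(3), of "?Y - {lam f}"] fin[OF F'] by auto
    have lX: "lam f \<notin> X" using f(6) lam_in[OF f(3)] by auto
    have q: "lpath (rho e0) (?es @ [g]) (rho g)"
      by (rule lpath_append[OF p]) (use g rho_in[of g] rho_lam[of g] lam_in[of g] in auto)
    have "set (?es @ [g]) \<subseteq> F" "length (?es @ [g]) + 2 \<le> 2 * k" "\<Union>(set (?es @ [g])) \<inter> X = {}"
      using f g Suc.prems lX by auto
    from half[OF g(1) this(1,2) q this(3)] obtain f' where f': "f' \<in> F" "rho f' = rho g"
      "\<Union>(set (?es @ [g])) \<inter> \<Union>{f'} \<subseteq> {rho f'}" "(\<Union>(set (?es @ [g])) \<union> f') \<inter> X = {}"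
      "G (lam f') \<inter> (\<Union>(set (?es @ [g])) \<union> insert (rho e0) X) \<subseteq> B i"
      by blast
    have "(par ^^ h) (lam f') = (par ^^ h) (lam e0)" using join f' g f(8)
      unfolding confined_def by metis
    moreover have "length (?es @ [g]) = 2 * Suc t" using f(1) by simp
    moreover have "lpath (rho e0) (?es @ [g]) (rho f')" using q f'(2) by simp
    ultimately show ?case using f' g F'
      by (intro exI[of _ "?es @ [g]"] exI[of _ f'] conjI) (simp_all add: f(2,3))
  qed
qed

text \<open>The cycle runs from the common ancestor to \<open>lam e\<close>, through
  \<open>e\<close>, \<open>es\<close> and \<open>f\<close> to \<open>lam f\<close>, and back along
  the other branch, which gives \<open>h + (length es + 2) + h\<close> edges. The branches meet only
  at their end because they are still apart one step before it.\<close>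

lemma cycle_through_join:
  assumes e: "e \<in> F" "f \<in> F" "set es \<subseteq> F" "lpath (rho e) es (rho f)"
    and 1: "\<Union>(set es) \<inter> f \<subseteq> {rho f}"
    and 2: "(\<Union>(set es) \<union> f) \<inter> (e - {rho e} \<union> G (lam e)) = {}"
    and 3: "G (lam f) \<inter> (\<Union>(set es) \<union> e) \<subseteq> B i"
    and h: "1 \<le> h" "h \<le> i" "(par ^^ h) (lam f) = (par ^^ h) (lam e)"
    and ne: "(par ^^ (h - 1)) (lam f) \<noteq> (par ^^ (h - 1)) (lam e)"
  shows "\<exists>C\<subseteq>E. linear_cycle r (2 * h + length es + 2) (\<Union>C) C"
proof -
  let ?a = "lam e" and ?q = "lam f" and ?z = "(par ^^ h) (lam e)"
  let ?ca = "chain G par h ?a" and ?cq = "chain G par h ?q"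
  have L: "?a \<in> L i" "?q \<in> L i" using lam_L e by auto
  have av: "g \<inter> B i = {}" if "g \<in> insert e (insert f (set es))" for g
    using that F_avoid e by auto
  \<comment> \<open>Only the first edge of a chain leaves \<open>B i\<close>. As the edges of
    \<open>F\<close> avoid \<open>B i\<close>, only that edge can meet the path.\<close>
  have chain_in: "\<Union>(set (chain G par h u)) \<subseteq> G u \<union> B i" if "u \<in> L i" for u
  proof -
    obtain m where m: "h = Suc m" using h by (cases h) auto
    obtain s where s: "i = Suc s" using i_pos by (cases i) auto
    have "par u \<in> L s" using par_in[of s u] that s by auto
    then have "\<Union>(set (chain G par m (par u))) \<subseteq> B i"
      using chain_sub[of "par u" s m] h m s by auto
    then show ?thesis using m by auto
  qed
  have single: "g \<inter> G (lam g) = {lam g}" if "g \<in> F" for g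
    using G_last[OF lam_L[OF that]] F_avoid[OF that] lam_in[OF that] that F_sub
    by (intro edge_inter_single) auto
  have pe: "lpath ?a (e # es @ [f]) ?q"
  proof -
    have "lpath (rho e) (es @ [f]) ?q"
      by (rule lpath_append[OF e(4)]) (use 1 e rho_in rho_lam lam_in in auto)
    moreover have "e \<inter> \<Union>(set (es @ [f])) \<subseteq> {rho e}" using 2 by auto
    moreover have "?a \<in> e" "rho e \<in> e" "?a \<noteq> rho e"
      using lam_in[OF e(1)] rho_in[OF e(1)] rho_lam[OF e(1)] by simp_all
    ultimately show ?thesis by (simp del: set_append) blast
  qed
  have avoid: "\<Union>(set (e # es @ [f])) \<inter> B i = {}" using av by auto
  have sep: "C \<inter> U \<subseteq> {v}" if "C \<subseteq> A \<union> B i" "U \<inter> B i = {}" "U \<inter> A \<subseteq> {v}" for A C U v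
    using that by blast
  have "\<Union>(set (e # es @ [f])) \<inter> G ?a \<subseteq> {?a}"
    using single[OF e(1)] 2 by auto
  from sep[OF chain_in[OF L(1)] avoid this]
  have "\<Union>(set ?ca) \<inter> \<Union>(set (e # es @ [f])) \<subseteq> {?a}" .
  then have p: "lpath ?z (rev ?ca @ (e # es @ [f])) ?q"
    using lpath_append[OF lpath_rev[OF lpath_chain[OF L(1), of h]] pe] h by simp
  have q: "lpath ?z (rev ?cq) ?q"
    using lpath_rev[OF lpath_chain[OF L(2), of h]] h by simp
  have "\<Union>(set ?ca) \<inter> \<Union>(set ?cq) \<subseteq> {?z}"
    using chain_disj[OF L, of "h - 1"] ne h by auto
  moreover have "\<Union>(set (e # es @ [f])) \<inter> G ?q \<subseteq> {?q}"
  proof -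
    have "v = ?q" if v: "v \<in> \<Union>(set (e # es @ [f]))" "v \<in> G ?q" for v
    proof (cases "v \<in> f")
      case True
      then have "v \<in> f \<inter> G ?q" using v by simp
      then show ?thesis using single[OF e(2)] by simp
    next
      case False
      then have "v \<in> B i" using v 3 by auto
      then show ?thesis using avoid v by blast
    qed
    then show ?thesis by blast
  qed
  from sep[OF chain_in[OF L(2)] avoid this]
  have "\<Union>(set ?cq) \<inter> \<Union>(set (e # es @ [f])) \<subseteq> {?q}" .
  ultimately have int: "\<Union>(set (rev ?ca @ (e # es @ [f]))) \<inter> \<Union>(set (rev ?cq)) \<subseteq> {?z, ?q}"
    by auto
  have "Suc (i - h) \<le> i" using h by linarith
  then have "?z \<in> B i"
    using par_pow_in[OF L(1), of h] L_sub[of "i - h"] B_mono[of "Suc (i - h)" i] h by auto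
  then have zq: "?z \<noteq> ?q" using L(2) L_disj[of i] by auto
  have sub: "set (rev ?ca @ (e # es @ [f])) \<union> set (rev ?cq) \<subseteq> E"
    using chain_edges[OF L(1), of h] chain_edges[OF L(2), of h] h e F_sub by auto
  let ?C = "set (rev ?ca @ (e # es @ [f])) \<union> set (rev ?cq)"
  have "linear_cycle r (length (rev ?ca @ (e # es @ [f])) + length (rev ?cq)) (\<Union>?C) ?C"
    by (rule linear_cycle_two_paths[OF p q zq int _ r3]) (use sub card_edge h(1) in auto)
  moreover have "length (rev ?ca @ (e # es @ [f])) + length (rev ?cq) = 2 * h + length es + 2"
    by simp
  ultimately have "linear_cycle r (2 * h + length es + 2) (\<Union>?C) ?C" by metis
  then show ?thesis using sub by blast
qed

text \<open>The path starts at a right vertex with left neighbours \<open>lam e\<close> and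
  \<open>lam e'\<close> that are apart after \<open>h - 1\<close> steps. After as many steps its end
  \<open>lam f\<close> is apart from at least one of them, and that one closes the cycle. As
  \<open>h\<close> does not depend on \<open>t\<close>, the even lengths are consecutive.\<close>

theorem consecutive_even_cycles:
  "\<exists>h\<ge>1. h \<le> i \<and> (\<forall>t<k. \<exists>C\<subseteq>E. linear_cycle r (2 * h + 2 + 2 * t) (\<Union>C) C)"
proof -
  obtain h e e' where h: "1 \<le> h" "h \<le> i" and e: "e \<in> F" "e' \<in> F" "rho e = rho e'"
    and ne: "(par ^^ (h - 1)) (lam e) \<noteq> (par ^^ (h - 1)) (lam e')"
    and join: "confined h"
    using highest_join by blast
  \<comment> \<open>Both candidates for the closing edge and both their tree edges are avoided,
    since the choice between them depends on where the path ends.\<close>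
  let ?X = "e \<union> e' \<union> G (lam e) \<union> G (lam e') - {rho e}"
  have notin: "rho g \<notin> G (lam g)" if "g \<in> F" for g
    using edge_eqI[of g "G (lam g)" "lam g" "rho g"] G_last[OF lam_L[OF that]] F_avoid[OF that]
      lam_in[OF that] rho_in[OF that] rho_lam[OF that] F_sub that by auto
  have GE: "G (lam e) \<in> E" "G (lam e') \<in> E" using G_last lam_L e by auto
  have fin: "finite ?X" using e F_sub finite_edge GE by auto
  have "card (e \<union> e' \<union> G (lam e) \<union> G (lam e')) \<le> 4 * r"
    using card_Un_le[of "e \<union> e' \<union> G (lam e)" "G (lam e')"] card_Un_le[of "e \<union> e'" "G (lam e)"]
      card_Un_le[of e e'] card_edge GE e F_sub by (auto simp: subset_iff)
  then have card: "card ?X \<le> 4 * r"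
    using card_Diff1_le[of "e \<union> e' \<union> G (lam e) \<union> G (lam e')" "rho e"] by linarith
  have ninX: "rho e \<notin> ?X" by simp
  have "\<exists>C\<subseteq>E. linear_cycle r (2 * h + 2 + 2 * t) (\<Union>C) C" if tk: "t < k" for t
  proof -
    obtain es f where f: "length es = 2 * t" "set es \<subseteq> F" "f \<in> F" "lpath (rho e) es (rho f)"
      "\<Union>(set es) \<inter> \<Union>{f} \<subseteq> {rho f}" "(\<Union>(set es) \<union> f) \<inter> ?X = {}"
      "G (lam f) \<inter> (\<Union>(set es) \<union> insert (rho e) ?X) \<subseteq> B i" "(par ^^ h) (lam f) = (par ^^ h) (lam e)"
      using alternating_path[OF e(1) fin ninX card join tk] by blast
    obtain g where g: "g \<in> {e, e'}" "(par ^^ (h - 1)) (lam f) \<noteq> (par ^^ (h - 1)) (lam g)"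
      using ne by (metis insertI1 insertI2)
    have gF: "g \<in> F" "rho g = rho e" using g(1) e by auto
    have sub: "g - {rho g} \<union> G (lam g) \<subseteq> ?X"
      using g(1) e notin[OF e(1)] notin[OF e(2)] by auto
    have "\<exists>C\<subseteq>E. linear_cycle r (2 * h + length es + 2) (\<Union>C) C"
    proof (rule cycle_through_join[of g f])
      show "(par ^^ h) (lam f) = (par ^^ h) (lam g)"
        using join gF e(1) f(8) unfolding confined_def by metis
      show "G (lam f) \<inter> (\<Union>(set es) \<union> g) \<subseteq> B i" using f(7) sub gF(2) by blast
      show "(\<Union>(set es) \<union> f) \<inter> (g - {rho g} \<union> G (lam g)) = {}" using f(6) sub by blast
    qed (use f g gF h in auto)
    then show ?thesis using f(1) by (simp add: algebra_simps)
  qed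
  then show ?thesis using h by blast
qed

end

section \<open>Cores of large minimum degree\<close>

lemma card_image_remove_fibre:
  assumes "finite A" "a \<in> A"
  shows "card (f ` (A - {b \<in> A. f b = f a})) < card (f ` A)"
proof (rule psubset_card_mono)
  have "f a \<notin> f ` (A - {b \<in> A. f b = f a})" by auto
  then show "f ` (A - {b \<in> A. f b = f a}) \<subset> f ` A" using assms(2) by blast
qed (use assms(1) in simp)

text \<open>\<open>F'\<close> is a smallest nonempty set that still satisfies the counting
  inequality. Removing a fibre with fewer than \<open>D\<close> edges would lower the right-hand
  side of that inequality by at least \<open>D\<close> and so preserve it.\<close>

lemma bipartite_core:
  fixes lam :: "'e \<Rightarrow> 'u" and rho :: "'e \<Rightarrow> 'v" and D :: nat
  assumes "finite F" "F \<noteq> {}" and big: "card F \<ge> D * (card (lam ` F) + card (rho ` F))"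
  obtains F' where "F' \<subseteq> F" "F' \<noteq> {}"
    "\<And>e. e \<in> F' \<Longrightarrow> card {f \<in> F'. lam f = lam e} \<ge> D"
    "\<And>e. e \<in> F' \<Longrightarrow> card {f \<in> F'. rho f = rho e} \<ge> D"
proof -
  let ?w = "\<lambda>F'. D * (card (lam ` F') + card (rho ` F'))"
  let ?Q = "\<lambda>F'. F' \<subseteq> F \<and> F' \<noteq> {} \<and> card F' \<ge> ?w F'"
  obtain F' where F': "?Q F'" and least: "\<And>F''. ?Q F'' \<Longrightarrow> card F' \<le> card F''"
    using ex_has_least_nat[of ?Q F card] assms by blast
  have fin: "finite F'" using F' assms(1) finite_subset by blast
  have stuck: "card S \<ge> D"
    if S: "S \<subseteq> F'" "S \<noteq> {}"
      and drop: "card (lam ` (F' - S)) + card (rho ` (F' - S)) < card (lam ` F') + card (rho ` F')" for S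
  proof (rule ccontr)
    assume "\<not> card S \<ge> D"
    moreover have c: "card (F' - S) + card S = card F'"
      using S(1) fin by (metis card_Diff_subset card_mono finite_subset le_add_diff_inverse2)
    moreover have "?w (F' - S) + D \<le> ?w F'"
    proof -
      have "D * Suc (card (lam ` (F' - S)) + card (rho ` (F' - S))) \<le> ?w F'"
        using drop by (intro mult_le_mono2) simp
      then show ?thesis by simp
    qed
    \<comment> \<open>The inequality becomes strict, which keeps the remaining set nonempty.\<close>
    ultimately have lt: "?w (F' - S) < card (F' - S)" using F' by linarith
    then have "F' - S \<noteq> {}" by (metis card.empty not_less_zero)
    then have "card F' \<le> card (F' - S)" using least[of "F' - S"] F' lt by auto
    moreover have "card S > 0" using S fin by (meson card_gt_0_iff finite_subset)
    ultimately show False using c by linarith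
  qed
  show ?thesis
  proof (rule that[of F'])
    fix e assume e: "e \<in> F'"
    show "card {f \<in> F'. lam f = lam e} \<ge> D"
      using e fin card_image_remove_fibre[OF fin e]
      by (intro stuck add_less_le_mono card_mono) auto
    show "card {f \<in> F'. rho f = rho e} \<ge> D"
      using e fin card_image_remove_fibre[OF fin e]
      by (intro stuck add_le_less_mono card_mono) auto
  qed (use F' in auto)
qed

text \<open>\<open>V'\<close> is a smallest nonempty set spanning at least
  \<open>q * card V'\<close> edges. Deleting a vertex of degree below \<open>q\<close> would make
  the inequality strict, which excludes the empty set and contradicts minimality.\<close>

lemma min_degree_core:
  fixes q :: real
  assumes "finite V" "finite E" "V \<noteq> {}" and sub: "\<And>e. e \<in> E \<Longrightarrow> e \<subseteq> V \<and> e \<noteq> {}"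
    and big: "real (card E) \<ge> q * real (card V)"
  obtains V' where "V' \<subseteq> V" "V' \<noteq> {}"
    "\<And>v. v \<in> V' \<Longrightarrow> real (card {e \<in> {e \<in> E. e \<subseteq> V'}. v \<in> e}) \<ge> q"
proof -
  let ?E = "\<lambda>V'. {e \<in> E. e \<subseteq> V'}"
  let ?Q = "\<lambda>V'. V' \<subseteq> V \<and> V' \<noteq> {} \<and> real (card (?E V')) \<ge> q * real (card V')"
  have "?E V = E" using sub by auto
  then have "?Q V" using assms by simp
  then obtain V' where V': "?Q V'" and least: "\<And>V''. ?Q V'' \<Longrightarrow> card V' \<le> card V''"
    using ex_has_least_nat[of ?Q V card] by blast
  have fin: "finite V'" using V' assms(1) finite_subset by blast
  have "real (card {e \<in> ?E V'. v \<in> e}) \<ge> q" if v: "v \<in> V'" for v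
  proof (rule ccontr)
    assume less: "\<not> ?thesis"
    have "card (?E V') = card (?E (V' - {v}) \<union> {e \<in> ?E V'. v \<in> e})"
      by (rule arg_cong[of _ _ card]) auto
    also have "card (?E (V' - {v}) \<union> {e \<in> ?E V'. v \<in> e})
        = card (?E (V' - {v})) + card {e \<in> ?E V'. v \<in> e}"
      using assms(2) by (intro card_Un_disjoint) auto
    finally have c: "card (?E V') = card (?E (V' - {v})) + card {e \<in> ?E V'. v \<in> e}" .
    have cV: "card V' = Suc (card (V' - {v}))" using v fin by (metis card_Suc_Diff1)
    have "q * real (card V') = q * real (card (V' - {v})) + q"
      using cV by (simp add: algebra_simps)
    then have gt: "real (card (?E (V' - {v}))) > q * real (card (V' - {v}))"
      using c less V' by linarith
    have "V' - {v} \<noteq> {}"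
    proof
      assume empty: "V' - {v} = {}"
      have "?E {} = {}" using sub by auto
      then have "real (card (?E {})) = 0" by (simp only: card.empty of_nat_0)
      then show False using gt unfolding empty
        by (simp only: card.empty of_nat_0 mult_zero_right less_irrefl)
    qed
    then have "?Q (V' - {v})" using gt V' by auto
    then show False using least[of "V' - {v}"] cV by simp
  qed
  then show ?thesis using that V' by blast
qed

section \<open>Growing the tree\<close>

text \<open>\<open>K\<close> is the factor by which the volume grows per level. The bound
  \<open>K \<ge> 2 * r ^ 2\<close> makes a new level outweigh all older vertices by the factor
  \<open>2 * r\<close>.\<close>

locale min_degree_graph = linear_r_graph r E
  for r :: nat and E :: "'a set set" +
  fixes V :: "'a set" and \<delta> K :: real and k :: nat
  assumes finV: "finite V" and E_sub: "e \<in> E \<Longrightarrow> e \<subseteq> V"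
    and min_degree: "v \<in> V \<Longrightarrow> real (card {e \<in> E. v \<in> e}) \<ge> \<delta>"
    and k2: "k \<ge> 2" and K_def: "K = \<delta> / (32 * real k * real r ^ 3)"
    and K_ge: "K \<ge> 2 * real r ^ 2"
begin

section \<open>Degrees and volumes\<close>

definition deg :: "'a \<Rightarrow> nat" where "deg v = card {e \<in> E. v \<in> e}"

definition vol :: "'a set \<Rightarrow> nat" where "vol S = (\<Sum>v\<in>S. deg v)"

lemma \<delta>_eq: "\<delta> = K * (32 * real k * real r ^ 3)"
  using k2 r3 unfolding K_def by simp

lemma K_ge_2: "K \<ge> 2"
proof -
  have "real r ^ 2 \<ge> 1" using r3 by simp
  then show ?thesis using K_ge by linarith
qed

lemma \<delta>_pos: "\<delta> > 0"
  unfolding \<delta>_eq using K_ge_2 k2 r3 by simp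

lemma vol_eq: "finite S \<Longrightarrow> vol S = (\<Sum>e\<in>E. card (e \<inter> S))"
proof -
  assume fin: "finite S"
  have "vol S = (\<Sum>v\<in>S. \<Sum>e\<in>E. if v \<in> e then 1 else 0)"
    unfolding vol_def deg_def using finE by (simp add: sum.If_cases Int_def)
  also have "\<dots> = (\<Sum>e\<in>E. \<Sum>v\<in>S. if v \<in> e then 1 else 0)" by (rule sum.swap)
  also have "\<dots> = (\<Sum>e\<in>E. card (e \<inter> S))"
    using fin by (intro sum.cong) (auto simp: sum.If_cases Int_def conj_commute)
  finally show ?thesis .
qed

lemma meeting_eq: "card {e \<in> E. e \<inter> S \<noteq> {}} = (\<Sum>e\<in>E. if e \<inter> S \<noteq> {} then 1 else 0)"
  using finE by (simp add: sum.If_cases Int_def)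

lemma meeting_le_vol: "finite S \<Longrightarrow> card {e \<in> E. e \<inter> S \<noteq> {}} \<le> vol S"
  unfolding meeting_eq vol_eq by (intro sum_mono) (auto simp: card_gt_0_iff Suc_le_eq)

lemma vol_le_meeting: "finite S \<Longrightarrow> vol S \<le> r * card {e \<in> E. e \<inter> S \<noteq> {}}"
proof -
  assume fin: "finite S"
  have "card (e \<inter> S) \<le> r" if "e \<in> E" for e
    using card_mono[of e "e \<inter> S"] finite_edge[OF that] card_edge[OF that] by simp
  then show ?thesis
    unfolding meeting_eq vol_eq[OF fin] sum_distrib_left by (intro sum_mono) auto
qed

lemma card_le_vol: "S \<subseteq> V \<Longrightarrow> \<delta> * real (card S) \<le> real (vol S)"
  using sum_mono[of S "\<lambda>_. \<delta>" "\<lambda>v. real (deg v)"] min_degree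
  unfolding vol_def deg_def by (auto simp: mult.commute subset_iff)

lemma vol_Un_le: "finite S \<Longrightarrow> finite T \<Longrightarrow> vol (S \<union> T) \<le> vol S + vol T"
  unfolding vol_def by (simp add: sum_Un_nat)

end

text \<open>The invariants of the growth: \<open>last_card\<close> bounds the right side of the
  bipartite graph, \<open>old_vol\<close> keeps the edges meeting \<open>B i\<close> few, and
  \<open>all_vol\<close> bounds the whole tree, from which \<open>old_vol\<close> follows on the
  next level.\<close>

locale growing_tree = min_degree_graph r E V \<delta> K k + level_tree r E x i L B par G
  for r :: nat and E :: "'a set set" and V \<delta> K k x i L B par G +
  assumes tree_sub: "B (Suc i) \<subseteq> V"
    and last_card: "card (B (Suc i) - B i) \<le> r * card (L i)"
    and old_vol: "2 * r * vol (B i) \<le> vol (L i)"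
    and all_vol: "vol (B (Suc i)) \<le> r * vol (L i)"
    and L_ne: "L i \<noteq> {}"
begin

lemma finB: "finite (B (Suc i))"
  using tree_sub finV finite_subset by blast

lemma L_subV: "L i \<subseteq> V" using L_sub[of i] tree_sub by auto

lemma finL: "finite (L i)"
  using L_subV finV finite_subset by blast

section \<open>Edges leaving the last level\<close>

definition forward :: "'a set set" where
  "forward = {e \<in> E. e \<inter> L i \<noteq> {} \<and> e \<inter> B i = {}}"

text \<open>At least \<open>vol (L i) / r\<close> edges meet the last level, and by
  \<open>old_vol\<close> at most \<open>vol (L i) / (2 * r)\<close> edges meet
  \<open>B i\<close>.\<close>

lemma card_forward: "vol (L i) \<le> 2 * r * card forward"
proof -
  have finBi: "finite (B i)" using finB B_Suc[of i] finite_subset by blast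
  have "{e \<in> E. e \<inter> L i \<noteq> {}} \<subseteq> forward \<union> {e \<in> E. e \<inter> B i \<noteq> {}}"
    unfolding forward_def by auto
  then have "card {e \<in> E. e \<inter> L i \<noteq> {}} \<le> card (forward \<union> {e \<in> E. e \<inter> B i \<noteq> {}})"
    using finE unfolding forward_def by (intro card_mono) auto
  also have "\<dots> \<le> card forward + card {e \<in> E. e \<inter> B i \<noteq> {}}" by (rule card_Un_le)
  also have "\<dots> \<le> card forward + vol (B i)" using meeting_le_vol[OF finBi] by simp
  finally have "r * card {e \<in> E. e \<inter> L i \<noteq> {}} \<le> r * (card forward + vol (B i))" by simp
  then have "vol (L i) \<le> r * card forward + r * vol (B i)"
    using vol_le_meeting[OF finL] by (simp add: algebra_simps)
  then show ?thesis using old_vol by linarith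
qed

lemma volL_pos: "vol (L i) > 0"
proof -
  have "0 < \<delta> * real (card (L i))" using \<delta>_pos L_ne finL by (simp add: card_gt_0_iff)
  then show ?thesis using card_le_vol[OF L_subV] by simp
qed

text \<open>Edge sets that can carry the next level: each edge hangs on one branching vertex, and
  distinct edges share no new vertex.\<close>

definition fresh_star :: "'a set set \<Rightarrow> bool" where
  "fresh_star M \<longleftrightarrow> M \<subseteq> E \<and> (\<forall>e\<in>M. \<exists>p\<in>L i. e \<inter> B (Suc i) = {p}) \<and>
     (\<forall>e\<in>M. \<forall>f\<in>M. e \<noteq> f \<longrightarrow> e \<inter> f \<subseteq> B (Suc i))"

text \<open>A forward edge that meets the tree only in \<open>p\<close> belongs to \<open>M\<close>
  or, by maximality, meets an edge of \<open>M\<close> outside the tree. Any other tree vertex of a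
  forward edge lies outside \<open>B i\<close>. The vertex found is the right end in the bipartite
  graph.\<close>

lemma second_vertex:
  assumes M: "fresh_star M" and maximal: "\<And>N. fresh_star N \<Longrightarrow> M \<subseteq> N \<Longrightarrow> M = N"
    and e: "e \<in> forward" "p \<in> e" "p \<in> L i"
  shows "\<exists>v\<in>e. v \<noteq> p \<and> v \<in> (B (Suc i) - B i) \<union> (\<Union>M - B (Suc i))"
proof (cases "e \<inter> B (Suc i) = {p}")
  case False
  then obtain v where "v \<in> e" "v \<in> B (Suc i)" "v \<noteq> p" using e L_sub[of i] by auto
  then show ?thesis using e unfolding forward_def by auto
next
  case single: True
  have eE: "e \<in> E" using e unfolding forward_def by auto
  show ?thesis
  proof (cases "e \<in> M")
    case True
    have "\<not> e \<subseteq> {p}"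
      using card_mono[of "{p}" e] card_edge[OF eE] r3 by auto
    then show ?thesis using True single by blast
  next
    case False
    then have "\<not> fresh_star (insert e M)" using maximal[of "insert e M"] by auto
    then obtain f where f: "f \<in> M" "\<not> e \<inter> f \<subseteq> B (Suc i)"
      using M eE single e(3) unfolding fresh_star_def by (auto simp: Int_commute)
    then show ?thesis using single by blast
  qed
qed

text \<open>The left side has at most \<open>card (L i)\<close> vertices; the right side has at most
  \<open>r * card (L i)\<close> in \<open>B (Suc i) - B i\<close> and \<open>r * card M\<close> in
  edges of \<open>M\<close>. So \<open>dense\<close> is the density that yields a core of minimum
  degree \<open>8 * k * r\<close>.\<close>

lemma cycles_if_dense:
  assumes M: "fresh_star M" and maximal: "\<And>N. fresh_star N \<Longrightarrow> M \<subseteq> N \<Longrightarrow> M = N"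
    and dense: "8 * k * r * ((r + 1) * card (L i) + r * card M) \<le> card forward"
  shows "\<exists>h\<ge>1. h \<le> i \<and> (\<forall>t<k. \<exists>C\<subseteq>E. linear_cycle r (2 * h + 2 + 2 * t) (\<Union>C) C)"
proof -
  let ?R = "(B (Suc i) - B i) \<union> (\<Union>M - B (Suc i))"
  define lam where "lam e = (SOME v. v \<in> e \<and> v \<in> L i)" for e
  define rho where "rho e = (SOME v. v \<in> e \<and> v \<noteq> lam e \<and> v \<in> ?R)" for e
  have lam: "lam e \<in> e" "lam e \<in> L i" if e: "e \<in> forward" for e
  proof -
    obtain v where "v \<in> e \<and> v \<in> L i" using e unfolding forward_def by auto
    then have "lam e \<in> e \<and> lam e \<in> L i" unfolding lam_def by (rule someI)
    then show "lam e \<in> e" "lam e \<in> L i" by auto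
  qed
  have rho: "rho e \<in> e" "rho e \<noteq> lam e" "rho e \<in> ?R" if e: "e \<in> forward" for e
  proof -
    obtain v where "v \<in> e \<and> v \<noteq> lam e \<and> v \<in> ?R"
      using second_vertex[OF M maximal e lam[OF e]] by blast
    then have "rho e \<in> e \<and> rho e \<noteq> lam e \<and> rho e \<in> ?R" unfolding rho_def by (rule someI)
    then show "rho e \<in> e" "rho e \<noteq> lam e" "rho e \<in> ?R" by auto
  qed
  have ME: "M \<subseteq> E" using M unfolding fresh_star_def by auto
  then have finM: "finite M" using finE finite_subset by blast
  have fin: "finite forward" using finE unfolding forward_def by simp
  have "card (\<Union>M) \<le> (\<Sum>e\<in>M. card e)" by (rule card_Union_le_sum_card)
  also have "\<dots> = r * card M" using ME card_edge by (subst sum.cong[OF refl, of _ _ "\<lambda>_. r"]) auto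
  finally have cM: "card (\<Union>M) \<le> r * card M" .
  have finUM: "finite (\<Union>M)" using finM ME finite_edge by auto
  have "card (\<Union>M - B (Suc i)) \<le> card (\<Union>M)" using finUM by (intro card_mono) auto
  then have cR: "card ?R \<le> r * card (L i) + r * card M"
    using card_Un_le[of "B (Suc i) - B i" "\<Union>M - B (Suc i)"] last_card cM by linarith
  have "card (rho ` forward) \<le> card ?R"
    using rho finB finUM by (intro card_mono) auto
  moreover have "card (lam ` forward) \<le> card (L i)"
    using lam finL by (intro card_mono) auto
  ultimately have "card (lam ` forward) + card (rho ` forward) \<le> (r + 1) * card (L i) + r * card M"
    using cR by (simp add: algebra_simps)
  then have "8 * k * r * (card (lam ` forward) + card (rho ` forward))
      \<le> 8 * k * r * ((r + 1) * card (L i) + r * card M)"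
    by (rule mult_le_mono2)
  then have big: "8 * k * r * (card (lam ` forward) + card (rho ` forward)) \<le> card forward"
    using dense by linarith
  have ne: "forward \<noteq> {}" using card_forward volL_pos by auto
  obtain F where F: "F \<subseteq> forward" "F \<noteq> {}"
    "\<And>e. e \<in> F \<Longrightarrow> card {f \<in> F. lam f = lam e} \<ge> 8 * k * r"
    "\<And>e. e \<in> F \<Longrightarrow> card {f \<in> F. rho f = rho e} \<ge> 8 * k * r"
    by (rule bipartite_core[OF fin ne big]) (rule that)
  interpret dense_level r E x i L B par G F lam rho k
  proof unfold_locales
    show "F \<subseteq> E" using F(1) unfolding forward_def by auto
    show "e \<inter> B i = {}" if "e \<in> F" for e using that F(1) unfolding forward_def by auto
  qed (use F k2 lam rho in auto)
  show ?thesis by (rule consecutive_even_cycles)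
qed

lemma maximal_fresh_star:
  obtains M where "fresh_star M" "\<And>N. fresh_star N \<Longrightarrow> M \<subseteq> N \<Longrightarrow> M = N"
proof -
  have "{M. fresh_star M} \<subseteq> Pow E" unfolding fresh_star_def by auto
  then have "finite {M. fresh_star M}" using finE by (meson finite_Pow_iff finite_subset)
  moreover have "fresh_star {}" unfolding fresh_star_def by simp
  ultimately show ?thesis using finite_has_maximal[of "{M. fresh_star M}"] that by blast
qed

text \<open>Sparsity bounds the volume \<open>v\<close> of the level by
  \<open>16 * k * r ^ 2 * (r + 1) * l + 16 * k * r ^ 3 * m\<close>. The first term is at most
  \<open>\<delta> * l / 2\<close>, hence at most \<open>v / 2\<close>, so
  \<open>v \<le> 32 * k * r ^ 3 * m\<close>. This is where the denominator of \<open>K\<close> comes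
  from.\<close>

lemma card_fresh_star:
  assumes sparse: "card forward < 8 * k * r * ((r + 1) * card (L i) + r * card M)"
  shows "K * real (vol (L i)) \<le> \<delta> * real (card M)"
proof -
  define v l m where "v = real (vol (L i))" and "l = real (card (L i))" and "m = real (card M)"
  define R kk where "R = real r" and "kk = real k"
  have pos: "R \<ge> 3" "kk \<ge> 2" "K \<ge> 2 * R ^ 2" using r3 k2 K_ge unfolding R_def kk_def by auto
  have \<delta>: "\<delta> = K * (32 * kk * R ^ 3)" using \<delta>_eq unfolding R_def kk_def .
  have "vol (L i) \<le> 2 * r * (8 * k * r * ((r + 1) * card (L i) + r * card M))"
    using card_forward sparse by (meson le_trans less_imp_le mult_le_mono2)
  then have "v \<le> real (2 * r * (8 * k * r * ((r + 1) * card (L i) + r * card M)))"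
    unfolding v_def of_nat_le_iff .
  then have 1: "v \<le> 16 * kk * R ^ 2 * (R + 1) * l + 16 * kk * R ^ 3 * m"
    unfolding R_def kk_def l_def m_def by (simp add: algebra_simps power2_eq_square power3_eq_cube)
  have 2: "K * (32 * kk * R ^ 3) * l \<le> v" using card_le_vol[OF L_subV] unfolding v_def l_def \<delta> .
  have "l \<ge> 0" unfolding l_def by simp
  have "2 * R \<le> K * R" using pos(1) K_ge_2 by (intro mult_right_mono) auto
  then have "R + 1 \<le> K * R" using pos(1) by linarith
  then have "16 * kk * R ^ 2 * (R + 1) * l \<le> 16 * kk * R ^ 2 * (K * R) * l"
    using pos(2) \<open>l \<ge> 0\<close> by (intro mult_right_mono mult_left_mono) auto
  also have "\<dots> = (K * (32 * kk * R ^ 3) * l) / 2" by (simp add: power2_eq_square power3_eq_cube)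
  finally have "v \<le> 32 * kk * R ^ 3 * m" using 1 2 by linarith
  then have "K * v \<le> K * (32 * kk * R ^ 3 * m)" using K_ge_2 by (intro mult_left_mono) auto
  then show ?thesis unfolding \<delta> v_def m_def by (simp add: mult.assoc)
qed

text \<open>Each edge of \<open>M\<close> branches at its new vertex \<open>act e\<close> of largest
  degree. The new vertices then have at most \<open>r - 1\<close> times the volume of the new level,
  which itself is at least \<open>\<delta> * card M\<close>.\<close>

lemma extend:
  assumes M: "fresh_star M" and card: "K * real (vol (L i)) \<le> \<delta> * real (card M)"
  obtains L' B' par' G' where "growing_tree r E V \<delta> K k x (Suc i) L' B' par' G'"
    "real (vol (L' (Suc i))) \<ge> K * real (vol (L i))"
proof -
  let ?S = "B (Suc i)"
  have ME: "M \<subseteq> E" and Mp: "\<And>e. e \<in> M \<Longrightarrow> \<exists>p\<in>L i. e \<inter> ?S = {p}"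
    and Mint: "\<And>e f. e \<in> M \<Longrightarrow> f \<in> M \<Longrightarrow> e \<noteq> f \<Longrightarrow> e \<inter> f \<subseteq> ?S"
    using M unfolding fresh_star_def by auto
  have finM: "finite M" using ME finE finite_subset by blast
  have finUM: "finite (\<Union>M)" using finM ME finite_edge by auto
  have new: "finite (e - ?S)" "card (e - ?S) = r - 1" "e - ?S \<noteq> {}" if eM: "e \<in> M" for e
  proof -
    have e: "finite e" "card e = r" using eM ME finite_edge card_edge by auto
    then show "finite (e - ?S)" by simp
    obtain p where "e \<inter> ?S = {p}" using Mp[OF eM] by auto
    then show c: "card (e - ?S) = r - 1" using card_Diff_subset_Int[of e ?S] e by simp
    show "e - ?S \<noteq> {}" 
    proof
      assume "e - ?S = {}"
      then have "r - 1 = 0" using c by (simp only: card.empty)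
      then show False using r3 by simp
    qed
  qed
  have "\<exists>v. v \<in> e - ?S \<and> (\<forall>u\<in>e - ?S. deg u \<le> deg v)" if eM: "e \<in> M" for e
  proof -
    have "Max (deg ` (e - ?S)) \<in> deg ` (e - ?S)" using new[OF eM] by (intro Max_in) auto
    then obtain v where "v \<in> e - ?S" "deg v = Max (deg ` (e - ?S))" by auto
    then show ?thesis using new(1)[OF eM] by auto
  qed
  then obtain act where act: "\<And>e. e \<in> M \<Longrightarrow> act e \<in> e - ?S"
      "\<And>e u. e \<in> M \<Longrightarrow> u \<in> e - ?S \<Longrightarrow> deg u \<le> deg (act e)"
    by metis
  have uniq: "e = f" if "e \<in> M" "f \<in> M" "v \<in> e" "v \<in> f" "v \<notin> ?S" for e f v
    using Mint[of e f] that by auto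
  have inj: "inj_on act M"
    by (rule inj_onI) (metis DiffE act(1) uniq)
  define L' where "L' = L(Suc i := act ` M)"
  define B' where "B' = B(Suc (Suc i) := ?S \<union> \<Union>M)"
  \<comment> \<open>A vertex outside the old tree lies in at most one edge of \<open>M\<close>, so
    the description is unambiguous on the new level.\<close>
  define G' where "G' u = (if u \<in> ?S then G u else (THE e. e \<in> M \<and> u \<in> e))" for u
  define par' where "par' u = (if u \<in> ?S then par u else (THE p. G' u \<inter> ?S = {p}))" for u
  have G'act: "G' (act e) = e" if "e \<in> M" for e
  proof -
    have "(THE f. f \<in> M \<and> act e \<in> f) = e"
      using act(1)[OF that] that uniq[of _ e "act e"] by (intro the_equality) auto
    then show ?thesis using act(1)[OF that] unfolding G'_def by auto
  qed
  have par'act: "par' (act e) \<in> L i" "e \<inter> ?S = {par' (act e)}" if eM: "e \<in> M" for e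
  proof -
    obtain p where p: "p \<in> L i" "e \<inter> ?S = {p}" using Mp[OF eM] by auto
    then have "par' (act e) = p" using act(1)[OF eM] G'act[OF eM] unfolding par'_def by auto
    then show "par' (act e) \<in> L i" "e \<inter> ?S = {par' (act e)}" using p by auto
  qed
  have oldL: "L s \<subseteq> ?S" if "s \<le> i" for s
    using L_sub[OF that] B_mono[of "Suc s" "Suc i"] that by auto
  have old: "G' u = G u" "par' u = par u" if "u \<in> L s" "s \<le> i" for u s
    using oldL[OF that(2)] that(1) unfolding G'_def par'_def by auto
  have L'_new: "L' (Suc i) = act ` M" and L'_old: "\<And>s. s \<le> i \<Longrightarrow> L' s = L s"
    unfolding L'_def by auto
  have B'_new: "B' (Suc (Suc i)) = ?S \<union> \<Union>M" and B'_old: "\<And>s. s \<le> Suc i \<Longrightarrow> B' s = B s"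
    unfolding B'_def by auto
  have tree: "level_tree r E x (Suc i) L' B' par' G'"
  proof unfold_locales
    show "L' 0 = {x}" "B' 0 = {}" "B' (Suc 0) = {x}" using L0 B0 B1 L'_old B'_old by auto
    show "L' s \<subseteq> B' (Suc s)" if "s \<le> Suc i" for s
      using that L_sub[of s] L'_old B'_old L'_new B'_new act(1) by (cases "s = Suc i") auto
    show "L' s \<inter> B' s = {}" if "s \<le> Suc i" for s
      using that L_disj[of s] L'_old B'_old L'_new act(1) by (cases "s = Suc i") auto
    show "B' s \<subseteq> B' (Suc s)" if "s \<le> Suc i" for s
      using that B_Suc[of s] B'_old B'_new by (cases "s = Suc i") auto
    fix s u assume s: "s < Suc i" "u \<in> L' (Suc s)"
    show "par' u \<in> L' s"
    proof (cases "s = i")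
      case True
      then show ?thesis using s L'_new L'_old par'act(1) by auto
    next
      case False
      then show ?thesis using s L'_old[of s] L'_old[of "Suc s"] old[of u "Suc s"] par_in[of s u] by auto
    qed
    show "G' u \<in> E"
    proof (cases "s = i")
      case True
      then show ?thesis using s L'_new G'act ME by auto
    next
      case False
      then show ?thesis using s L'_old[of "Suc s"] old[of u "Suc s"] G_edge[of s u] by auto
    qed
    show "u \<in> G' u"
    proof (cases "s = i")
      case True
      then show ?thesis using s L'_new G'act act(1) by auto
    next
      case False
      then show ?thesis using s L'_old[of "Suc s"] old[of u "Suc s"] G_self[of s u] by auto
    qed
    show "G' u \<subseteq> B' (Suc (Suc s))"
    proof (cases "s = i")
      case True
      then show ?thesis using s L'_new G'act B'_new by auto
    next
      case False
      then show ?thesis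
        using s L'_old[of "Suc s"] old[of u "Suc s"] G_sub[of s u] B'_old[of "Suc (Suc s)"] by auto
    qed
    show "G' u \<inter> B' (Suc s) = {par' u}"
    proof (cases "s = i")
      case True
      then obtain e where "e \<in> M" "u = act e" using s L'_new by auto
      then show ?thesis using True G'act par'act(2) B'_old[of "Suc i"] by auto
    next
      case False
      then show ?thesis
        using s L'_old[of "Suc s"] old[of u "Suc s"] G_inter[of s u] B'_old[of "Suc s"] by auto
    qed
    fix u' assume u': "u' \<in> L' (Suc s)" "u \<noteq> u'"
    show "G' u \<inter> G' u' \<subseteq> B' (Suc s)"
    proof (cases "s = i")
      case True
      then obtain e e' where "e \<in> M" "u = act e" "e' \<in> M" "u' = act e'" using s u' L'_new by auto
      then show ?thesis using True G'act Mint[of e e'] B'_old[of "Suc i"] u'(2) by auto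
    next
      case False
      then show ?thesis
        using s u' L'_old[of "Suc s"] old[of u "Suc s"] old[of u' "Suc s"] G_disj[of s u u']
          B'_old[of "Suc s"] by auto
    qed
  qed
  have cL': "card (act ` M) = card M" using inj by (rule card_image)
  have actV: "act ` M \<subseteq> V" using act(1) ME E_sub by auto
  have grow: "real (vol (act ` M)) \<ge> K * real (vol (L i))"
    using card card_le_vol[OF actV] cL' by simp
  have "vol (\<Union>M - ?S) \<le> (\<Sum>e\<in>M. vol (e - ?S))"
  proof -
    have "(\<Sum>v\<in>(\<Union>e\<in>M. e - ?S). deg v) = (\<Sum>e\<in>M. \<Sum>v\<in>e - ?S. deg v)"
      by (rule sum.UNION_disjoint) (use finM new(1) uniq in blast)+
    moreover have "(\<Union>e\<in>M. e - ?S) = \<Union>M - ?S" by auto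
    ultimately have "vol (\<Union>M - ?S) = (\<Sum>e\<in>M. vol (e - ?S))"
      unfolding vol_def by (simp only:)
    then show ?thesis by simp
  qed
  also have "\<dots> \<le> (\<Sum>e\<in>M. (r - 1) * deg (act e))"
  proof (rule sum_mono)
    fix e assume e: "e \<in> M"
    have "vol (e - ?S) \<le> (\<Sum>v\<in>e - ?S. deg (act e))"
      unfolding vol_def by (rule sum_mono) (use act(2)[OF e] in auto)
    then show "vol (e - ?S) \<le> (r - 1) * deg (act e)" using new(2)[OF e] by simp
  qed
  also have "\<dots> = (r - 1) * vol (act ` M)"
    unfolding vol_def using inj by (simp add: sum.reindex sum_distrib_left)
  finally have newvol: "vol (\<Union>M - ?S) \<le> (r - 1) * vol (act ` M)" .
  have "real r * real (vol ?S) \<le> real r * (real r * real (vol (L i)))"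
    using all_vol by (intro mult_left_mono) (simp_all flip: of_nat_mult)
  then have "2 * real r * real (vol ?S) \<le> 2 * real r ^ 2 * real (vol (L i))"
    by (simp add: power2_eq_square)
  also have "\<dots> \<le> K * real (vol (L i))" using K_ge by (intro mult_right_mono) auto
  finally have "real (2 * r * vol ?S) \<le> real (vol (act ` M))" using grow by simp
  then have oldvol: "2 * r * vol ?S \<le> vol (act ` M)" unfolding of_nat_le_iff .
  have "growing_tree r E V \<delta> K k x (Suc i) L' B' par' G'"
  proof (intro growing_tree.intro growing_tree_axioms.intro tree min_degree_graph_axioms)
    show "B' (Suc (Suc i)) \<subseteq> V" using B'_new tree_sub ME E_sub by blast
    have "?S \<union> \<Union>M - ?S \<subseteq> \<Union>M" by auto
    then have "card (?S \<union> \<Union>M - ?S) \<le> card (\<Union>M)" using finUM by (intro card_mono)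
    also have "\<dots> \<le> (\<Sum>e\<in>M. card e)" by (rule card_Union_le_sum_card)
    also have "\<dots> = r * card M" using ME card_edge by (subst sum.cong[OF refl, of _ _ "\<lambda>_. r"]) auto
    finally show "card (B' (Suc (Suc i)) - B' (Suc i)) \<le> r * card (L' (Suc i))"
      using B'_new B'_old[of "Suc i"] L'_new cL' by simp
    show "2 * r * vol (B' (Suc i)) \<le> vol (L' (Suc i))"
      using oldvol B'_old[of "Suc i"] L'_new by simp
    \<comment> \<open>The new vertices weigh at most \<open>r - 1\<close> times the new level and
      the old tree at most once, altogether \<open>r\<close> times.\<close>
    have "vol (?S \<union> \<Union>M) \<le> vol ?S + vol (\<Union>M - ?S)"
      using vol_Un_le[of ?S "\<Union>M - ?S"] finB finUM by simp
    also have "\<dots> \<le> 2 * r * vol ?S + (r - 1) * vol (act ` M)"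
      using newvol r3 by (intro add_mono) auto
    also have "\<dots> \<le> vol (act ` M) + (r - 1) * vol (act ` M)" using oldvol by simp
    also have "\<dots> = r * vol (act ` M)" using r3 by (cases r) auto
    finally show "vol (B' (Suc (Suc i))) \<le> r * vol (L' (Suc i))"
      using B'_new L'_new by simp
    have "0 < K * real (vol (L i))" using volL_pos K_ge_2 by simp
    then have "vol (act ` M) > 0" using grow by simp
    then show "L' (Suc i) \<noteq> {}" using L'_new unfolding vol_def by auto
  qed
  then show ?thesis using that grow L'_new by simp
qed

lemma cycles_or_extend:
  assumes "\<not> (\<exists>h\<ge>1. h \<le> i \<and> (\<forall>t<k. \<exists>C\<subseteq>E. linear_cycle r (2 * h + 2 + 2 * t) (\<Union>C) C))"
  obtains L' B' par' G' where "growing_tree r E V \<delta> K k x (Suc i) L' B' par' G'"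
    "real (vol (L' (Suc i))) \<ge> K * real (vol (L i))"
proof -
  obtain M where M: "fresh_star M" "\<And>N. fresh_star N \<Longrightarrow> M \<subseteq> N \<Longrightarrow> M = N"
    using maximal_fresh_star by blast
  have "card forward < 8 * k * r * ((r + 1) * card (L i) + r * card M)"
    using cycles_if_dense[OF M] assms by (meson not_le)
  then show ?thesis using extend[OF M(1) card_fresh_star] that by blast
qed

end

section \<open>Termination of the growth\<close>

context min_degree_graph
begin

text \<open>The root has maximum degree, so no level has volume above \<open>card V * deg x\<close>,
  whereas growth up to level \<open>i\<close> forces at least \<open>K ^ i * deg x\<close>. As
  \<open>K \<ge> 2\<close>, the growth ends, and it can end only with cycles.\<close>

theorem short_consecutive_even_cycles:
  assumes "V \<noteq> {}"
  shows "\<exists>i h. 1 \<le> h \<and> h \<le> i \<and> K ^ i \<le> real (card V) \<and>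
    (\<forall>t<k. \<exists>C\<subseteq>E. linear_cycle r (2 * h + 2 + 2 * t) (\<Union>C) C)"
proof (rule ccontr)
  assume no: "\<not> ?thesis"
  have "Max (deg ` V) \<in> deg ` V" using finV assms by (intro Max_in) auto
  then obtain x where x: "x \<in> V" "deg x = Max (deg ` V)" by auto
  then have max: "deg v \<le> deg x" if "v \<in> V" for v using finV that by simp
  have degx: "deg x > 0" using min_degree[OF x(1)] \<delta>_pos unfolding deg_def by simp
  have bound: "K ^ i \<le> real (card V)"
    if T: "growing_tree r E V \<delta> K k x i L B par G" "K ^ i * real (deg x) \<le> real (vol (L i))" for i L B par G
  proof -
    interpret growing_tree r E V \<delta> K k x i L B par G by (rule T(1))
    have "vol (L i) \<le> (\<Sum>v\<in>L i. deg x)" unfolding vol_def using max L_subV by (intro sum_mono) auto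
    also have "\<dots> \<le> card V * deg x" using L_subV finV by (simp add: card_mono)
    finally have "real (vol (L i)) \<le> real (card V * deg x)" unfolding of_nat_le_iff .
    then have "K ^ i * real (deg x) \<le> real (card V) * real (deg x)" using T(2) by simp
    then show ?thesis using degx by simp
  qed
  have "\<exists>L B par G. growing_tree r E V \<delta> K k x i L B par G \<and> K ^ i * real (deg x) \<le> real (vol (L i))" for i
  proof (induction i)
    case 0
    \<comment> \<open>The tree is the root alone. For \<open>i = 0\<close> only \<open>L 0\<close>,
      \<open>B 0\<close> and \<open>B (Suc 0)\<close> matter; all other values are defaults.\<close>
    have "growing_tree r E V \<delta> K k x 0 (\<lambda>_. {x}) (\<lambda>s. if s = 0 then {} else {x}) id (\<lambda>_. {})"
      by unfold_locales (use x r3 in \<open>auto simp: vol_def\<close>)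
    then show ?case by (intro exI conjI) (auto simp: vol_def)
  next
    case (Suc i)
    then obtain L B par G where T: "growing_tree r E V \<delta> K k x i L B par G"
      "K ^ i * real (deg x) \<le> real (vol (L i))" by blast
    interpret growing_tree r E V \<delta> K k x i L B par G by (rule T(1))
    have "\<not> (\<exists>h\<ge>1. h \<le> i \<and> (\<forall>t<k. \<exists>C\<subseteq>E. linear_cycle r (2 * h + 2 + 2 * t) (\<Union>C) C))"
      using no bound[OF T] by blast
    then obtain L' B' par' G' where T': "growing_tree r E V \<delta> K k x (Suc i) L' B' par' G'"
      "real (vol (L' (Suc i))) \<ge> K * real (vol (L i))"
      by (rule cycles_or_extend)
    have "K * (K ^ i * real (deg x)) \<le> K * real (vol (L i))"
      using T(2) K_ge_2 by (intro mult_left_mono) auto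
    then have "K ^ Suc i * real (deg x) \<le> real (vol (L' (Suc i)))" using T'(2) by simp
    then show ?case using T'(1) by blast
  qed
  then have all: "K ^ i \<le> real (card V)" for i using bound by blast
  have "real (card V) < 2 ^ card V" by (rule of_nat_less_two_power)
  also have "\<dots> \<le> K ^ card V" using K_ge_2 by (intro power_mono) auto
  finally show False using all[of "card V"] by simp
qed

end

section \<open>From average degree to minimum degree, and the bound on the length\<close>

theorem theorem1p3:
  fixes r k n :: nat and c1 c2 d :: real and V :: "'a set" and E :: "'a set set"
  assumes "r \<ge> 3" and "k \<ge> 2"
    and "c1 = 128 * real r ^ (2 * r + 3)"
    and "c2 = log 2 (64 * real k * real r ^ (2 * r + 2))"
    and "r_graph r V E" and "linear_hypergraph E"
    and "n = card V" and "d = avg_degree r V E"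
    and "d \<ge> c1 * real k"
  shows "\<exists>a. even a \<and>
           (\<forall>i<k. contains_linear_cycle r V E (a + 2 * i)) \<and>
           (log 2 (d / real k) - c2 > 0 \<longrightarrow>
              int a \<le> 2 * \<lceil>log 2 (real n) / (log 2 (d / real k) - c2)\<rceil>)"
proof -
  note r = \<open>r \<ge> 3\<close> and k = \<open>k \<ge> 2\<close>
  have fV: "finite V" and E: "\<And>e. e \<in> E \<Longrightarrow> e \<subseteq> V \<and> card e = r"
    using \<open>r_graph r V E\<close> unfolding r_graph_def by auto
  have finE: "finite E" by (rule finite_subset[of _ "Pow V"]) (use E fV in auto)
  define \<delta> K where "\<delta> = d / real r" and "K = \<delta> / (32 * real k * real r ^ 3)"
  \<comment> \<open>As \<open>K = d / (32 * k * r ^ 4)\<close>, the condition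
    \<open>K \<ge> 2 * r ^ 2\<close> amounts to \<open>d \<ge> 64 * r ^ 6 * k\<close>, which follows
    from the size of \<open>c1\<close>.\<close>
  have "real r ^ 9 \<le> real r ^ (2 * r + 3)" using r by (intro power_increasing) auto
  moreover have "real r ^ 6 \<le> real r ^ 9" using r by (intro power_increasing) auto
  moreover have "0 \<le> real r ^ 6" by simp
  ultimately have "64 * real r ^ 6 \<le> c1" unfolding assms(3) by linarith
  then have "64 * real r ^ 6 * real k \<le> c1 * real k" by (rule mult_right_mono) simp
  then have d: "64 * real r ^ 6 * real k \<le> d" using assms(9) by linarith
  moreover have "0 < 64 * real r ^ 6 * real k" using r k by simp
  ultimately have d0: "d > 0" by linarith
  have K: "K = d / (32 * real k * real r ^ 4)"
    unfolding K_def \<delta>_def by (simp add: power_numeral_reduce mult_ac)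
  have "2 * real r ^ 2 = 64 * real r ^ 6 * real k / (32 * real k * real r ^ 4)"
    using r k by (simp add: field_simps flip: power_add)
  also have "\<dots> \<le> K" unfolding K using d by (intro divide_right_mono) auto
  finally have K_ge: "K \<ge> 2 * real r ^ 2" .
  have V0: "card V > 0" using d0 unfolding assms(8) avg_degree_def by (cases "card V") auto
  have many: "real (card E) \<ge> \<delta> * real (card V)"
    using V0 r unfolding \<delta>_def assms(8) avg_degree_def by simp
  have sub: "e \<subseteq> V \<and> e \<noteq> {}" if "e \<in> E" for e using E[OF that] r by auto
  have "V \<noteq> {}" using V0 by auto
  obtain V' where V': "V' \<subseteq> V" "V' \<noteq> {}"
    "\<And>v. v \<in> V' \<Longrightarrow> real (card {e \<in> {e \<in> E. e \<subseteq> V'}. v \<in> e}) \<ge> \<delta>"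
    by (rule min_degree_core[OF fV finE \<open>V \<noteq> {}\<close> sub many]) (assumption, rule that)
  interpret min_degree_graph r "{e \<in> E. e \<subseteq> V'}" V' \<delta> K k
  proof
    show "card (e \<inter> f) \<le> 1" if "e \<in> {e \<in> E. e \<subseteq> V'}" "f \<in> {e \<in> E. e \<subseteq> V'}" "e \<noteq> f" for e f
      using that assms(6) unfolding linear_hypergraph_def by blast
    show "finite V'" using V'(1) fV by (rule finite_subset)
  qed (use r k finE E V'(3) K_ge K_def in auto)
  obtain i h where ih: "1 \<le> h" "h \<le> i" "K ^ i \<le> real (card V')"
    and cyc: "\<forall>t<k. \<exists>C\<subseteq>{e \<in> E. e \<subseteq> V'}. linear_cycle r (2 * h + 2 + 2 * t) (\<Union>C) C"
    using short_consecutive_even_cycles[OF V'(2)] by blast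
  have "contains_linear_cycle r V E (2 * h + 2 + 2 * t)" if tk: "t < k" for t
  proof -
    obtain C where "C \<subseteq> {e \<in> E. e \<subseteq> V'}" "linear_cycle r (2 * h + 2 + 2 * t) (\<Union>C) C"
      using cyc tk by blast
    moreover from this(1) have "\<Union>C \<subseteq> V" "C \<subseteq> E" using V'(1) by auto
    ultimately show ?thesis unfolding contains_linear_cycle_def by blast
  qed
  moreover have "int (2 * h + 2) \<le> 2 * \<lceil>log 2 (real n) / (log 2 (d / real k) - c2)\<rceil>"
    if pos: "log 2 (d / real k) - c2 > 0"
  proof -
    \<comment> \<open>\<open>y\<close> is the number whose logarithm is the denominator of the
      bound; it lies below the growth factor \<open>K\<close>.\<close>
    define y where "y = d / real k / (64 * real k * real r ^ (2 * r + 2))"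
    have ly: "log 2 (d / real k) - c2 = log 2 y"
      unfolding y_def assms(4) using d0 r k by (subst log_divide) auto
    have y0: "y > 0" unfolding y_def using d0 r k by simp
    have "y < K"
    proof -
      have "real r ^ 4 \<le> real r ^ (2 * r + 2)" using r by (intro power_increasing) auto
      then have "32 * real k * real r ^ 4 < real k * (64 * real k * real r ^ (2 * r + 2))"
      proof -
        assume le: "real r ^ 4 \<le> real r ^ (2 * r + 2)"
        have "32 * real k * real r ^ 4 \<le> 32 * real k * real r ^ (2 * r + 2)"
          using le by (intro mult_left_mono) auto
        also have "\<dots> < real k * (64 * real k * real r ^ (2 * r + 2))"
          using k r by simp
        finally show ?thesis .
      qed
      then have "d / (real k * (64 * real k * real r ^ (2 * r + 2))) < K"
        unfolding K using d0 r k by (intro divide_strict_left_mono) auto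
      then show ?thesis unfolding y_def by simp
    qed
    \<comment> \<open>Strict because \<open>i \<ge> h \<ge> 1\<close>. Thus \<open>i\<close> lies
      strictly below the ceiling, which makes up for the extra \<open>2\<close> in the length
      \<open>2 * h + 2\<close>.\<close>
    then have "y ^ i < K ^ i" using y0 ih by (intro power_strict_mono) auto
    also have "\<dots> \<le> real n"
      using ih(3) card_mono[OF fV V'(1)] assms(7) by linarith
    finally have "log 2 (y ^ i) < log 2 (real n)"
      using y0 by (intro log_less) auto
    then have "real i * log 2 y < log 2 (real n)" using y0 by (simp add: log_nat_power)
    then have "real i < log 2 (real n) / log 2 y" using pos unfolding ly by (simp add: pos_less_divide_eq)
    then have "int i < \<lceil>log 2 (real n) / log 2 y\<rceil>" by (simp add: less_ceiling_iff)
    then show ?thesis unfolding ly using ih(2) by linarith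
  qed
  ultimately show ?thesis by (intro exI[of _ "2 * h + 2"]) auto
qed

end
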